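(* There exists an absolute constant $c > 0$ such that the following holds. Let $N \geq 3$ be an integer and let $A$ and $B$ be non-empty subsets of $\{1,\ldots,N\}$ with densities $\alpha = |A|/N$ and $\beta = |B|/N$. Then $A+B$ contains an arithmetic progression of length at least \[ \exp\left( c \left(\frac{\alpha \log N}{(\log (2\beta^{-1}))^3} \right)^{1/2} - \log( \beta^{-1} \log N) \right). \]
   Context: $A+B = \{a+b : a \in A, b \in B\}$. An arithmetic progression of length $L$ is a set of $L$ distinct integers of the form $\{a, a+d, \ldots, a+(L-1)d\}$ with $d \neq 0$. Logarithms are natural. *)

theory Defs
  imports Complex_Main "HOL-Library.Set_Algebras"
begin

(* The side condition d ~= 0 makes the L listed terms distinct, so the set has exactly L elements. *)
definition is_arith_prog :: "nat \<Rightarrow> int set \<Rightarrow> bool" where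
  "is_arith_prog L P \<longleftrightarrow> (\<exists>a d :: int. d \<noteq> 0 \<and> P = {a + int i * d | i. i < L})"

end

theory Submission
  imports Defs "HOL-Analysis.Analysis"
begin

text \<open>
  Work in \<open>\<int>/M\<close> with \<open>M = 4 N\<close>, write \<open>\<alpha>\<close> and \<open>\<beta>\<close> for the densities of \<open>A\<close> and \<open>B\<close>, and let
  \<open>F(x)\<close> be the proportion of \<open>b \<in> B\<close> with \<open>x - b \<in> A\<close>. Then \<open>F\<close> is positive exactly on \<open>A + B\<close>
  modulo \<open>M\<close>, so it suffices to find \<open>x\<close> and \<open>t\<close> with \<open>F(x + j t) > 0\<close> for all \<open>j < L\<close>. If
  \<open>t, 2 t, \<dots>, (L - 1) t\<close> are almost periods in a high power mean, in the sense that
  \<open>\<Sum>\<^sub>x (F(x + j t) - F(x))\<^sup>2\<^sup>m \<le> 4\<^sup>-\<^sup>m \<Sum>\<^sub>x F(x)\<^sup>2\<^sup>m\<close> for each \<open>j\<close>, and \<open>L < 4\<^sup>m\<close>, then summing over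
  \<open>j\<close> produces an \<open>x\<close> at which no \<open>F(x + j t)\<close> can vanish. The task is thus to find a Bohr set of small
  rank consisting of such almost periods: by Dirichlet's theorem a Bohr set of rank \<open>d\<close> contains a
  long progression \<open>t, 2 t, \<dots>\<close> as soon as \<open>m d\<close> is less than a small multiple of \<open>log N\<close>.

  The almost periods come from random sampling, used twice.

  First (Croot and Sisask), \<open>F\<close> is the average over \<open>b \<in> B\<close> of translates of the indicator function
  of \<open>A\<close>, and most samples of size \<open>k\<close> approximate it. At \<open>x\<close> the sampled quantity has variance
  at most \<open>F(x)\<close>, not merely at most \<open>1\<close>; since the mean of \<open>F\<close> is \<open>\<alpha>\<close>, this is why
  \<open>k = O(m l\<^sup>2 / \<alpha>)\<close>, with only one factor \<open>1/\<alpha>\<close>, is enough for a relative error \<open>1/l\<close>.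
  Pigeonholing the good samples over their translates gives a set \<open>T\<close> of density about \<open>\<beta>\<^sup>k\<close> all
  of whose differences are almost periods with error \<open>1/l\<close>. Hence \<open>F\<close> stays close to \<open>H\<close>, obtained
  from \<open>F\<close> by averaging \<open>l\<close> times over the differences of \<open>T\<close>
  (\<open>almost_periods\<close>, \<open>difference_average_iterate_close\<close>).

  Secondly, the Fourier coefficient of \<open>H\<close> at \<open>r\<close> is that of \<open>F\<close> multiplied by
  \<open>|\<tau>(r)|\<^sup>2\<^sup>l\<close>, where \<open>\<tau>\<close> is the transform of the uniform measure on \<open>T\<close>. Frequencies with
  \<open>|\<tau>(r)| \<ge> 1/2\<close> are controlled by Chang's theorem: they are combinations, with coefficients in
  \<open>{-1, 0, 1}\<close>, of \<open>O(log (1 / density of T)) = O(k log (1/\<beta>))\<close> frequencies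
  (\<open>chang_dissociated\<close>, \<open>exists_dissociated_spanning\<close>). For the other frequencies, \<open>l\<close> of size
  \<open>log (2/\<beta>)\<close> brings the sum of the absolute values of the coefficients down from
  \<open>(\<alpha>/\<beta>)\<^sup>1\<^sup>/\<^sup>2\<close> to \<open>\<alpha>\<^sup>1\<^sup>/\<^sup>2\<close>, and then a random sample of
  \<open>O(m/\<alpha>)\<close> characters approximates that part of \<open>H\<close> within a small multiple of \<open>\<alpha>\<close>
  (\<open>trig_polynomial_sparsification\<close>).

  Altogether the rank is \<open>d = O(m log\<^sup>3(2/\<beta>) / \<alpha>)\<close> (\<open>positive_progression\<close>), and the condition
  on \<open>m d\<close> allows \<open>m\<close> to be a small multiple of
  \<open>(\<alpha> log N / log\<^sup>3(2/\<beta>))\<^sup>1\<^sup>/\<^sup>2\<close>, with \<open>L = 2\<^sup>m\<close>. The widths of the Bohr set are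
  polynomial in \<open>\<beta>\<close>, \<open>1 / log N\<close> and \<open>2\<^sup>-\<^sup>m\<close>. They are harmless, because the claim is trivial unless
  \<open>log (\<beta>\<^sup>-\<^sup>1 log N)\<close> is smaller than a small multiple of that square root.
\<close>

section \<open>Moments of sample means\<close>

lemma power_div_fact_le_exp:
  fixes x :: real
  assumes "0 \<le> x"
  shows "x ^ n / fact n \<le> exp x"
proof -
  have "(\<Sum>i\<in>{n}. inverse (fact i) * x ^ i) \<le> (\<Sum>i. inverse (fact i) * x ^ i)"
    using assms by (intro sum_le_suminf) (auto simp: summable_exp)
  then show ?thesis
    by (simp add: exp_def scaleR_conv_of_real field_simps)
qed

text \<open>
  The left-hand side divided by \<open>(2 m)!\<close> is a term of the exponential series at
  \<open>|y|\<close>. This is how exponential moments are turned into power moments.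
\<close>
lemma even_power_le_exp_exp:
  fixes y :: real
  shows "y ^ (2 * m) \<le> fact (2 * m) * (exp y + exp (- y))"
proof -
  have "y ^ (2 * m) = \<bar>y\<bar> ^ (2 * m)" by (simp add: power_even_abs)
  also have "\<dots> \<le> fact (2 * m) * exp \<bar>y\<bar>"
    using power_div_fact_le_exp[of "\<bar>y\<bar>" "2 * m"] by (simp add: field_simps)
  also have "exp \<bar>y\<bar> \<le> exp y + exp (- y)" by (cases "y \<ge> 0") auto
  finally show ?thesis by simp
qed

lemma exp_le_quadratic:
  fixes y :: real
  assumes "\<bar>y\<bar> \<le> 1"
  shows "exp y \<le> 1 + y + y\<^sup>2"
proof (cases "0 \<le> y")
  case True
  then show ?thesis using exp_bound[of y] assms by simp
next
  case False
  define x where "x = - y"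
  have x: "0 < x" "x \<le> 1" using False assms by (auto simp: x_def)
  have lower: "1 + x + x\<^sup>2 / 2 \<le> exp x"
    using exp_lower_Taylor_quadratic[of x] x by simp
  have "1 \<le> (1 - x + x\<^sup>2) * (1 + x + x\<^sup>2 / 2)"
  proof -
    have "(1 - x + x\<^sup>2) * (1 + x + x\<^sup>2 / 2) = 1 + x\<^sup>2 / 2 + x ^ 3 / 2 + x ^ 4 / 2"
      by (simp add: field_simps power2_eq_square power3_eq_cube power4_eq_xxxx)
    then show ?thesis using x by simp
  qed
  also have "\<dots> \<le> (1 - x + x\<^sup>2) * exp x"
    using lower x by (intro mult_left_mono) (auto intro: add_nonneg_nonneg)
  finally have "exp (- x) \<le> 1 - x + x\<^sup>2"
    by (simp add: exp_minus field_simps)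
  then show ?thesis by (simp add: x_def)
qed

text \<open>
  Independence: over tuples carrying the product weight, the expectation of a product is the product
  of the expectations.
\<close>
lemma sum_weighted_tuples:
  fixes w g :: "'a \<Rightarrow> real"
  assumes "finite \<Omega>"
  shows "(\<Sum>f\<in>PiE {..<k} (\<lambda>_. \<Omega>). (\<Prod>i<k. w (f i)) * (\<Prod>i<k. g (f i)))
          = (\<Sum>\<omega>\<in>\<Omega>. w \<omega> * g \<omega>) ^ k"
  using prod_sum_PiE[of "{..<k}" "\<lambda>_. \<Omega>" "\<lambda>_ \<omega>. w \<omega> * g \<omega>"] assms
  by (simp add: prod.distrib)

lemma sum_tuple_weights:
  fixes w :: "'a \<Rightarrow> real" and k :: nat
  assumes "finite \<Omega>" "sum w \<Omega> = 1"
  shows "(\<Sum>f\<in>PiE {..<k} (\<lambda>_. \<Omega>). \<Prod>i<k. w (f i)) = 1"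
  using sum_weighted_tuples[where \<Omega> = \<Omega> and k = k and w = w and g = "\<lambda>_. 1", OF assms(1)]
  by (simp add: assms(2))

text \<open>
  The estimate of Bernstein: as the exponent is at most 1 in absolute value, the quadratic
  bound on the exponential is available, its linear term averages to 0 and its quadratic term is
  controlled by the second moment. It is essential later that \<open>v\<close> may be much smaller than 1.
\<close>
lemma centred_exp_moment:
  fixes w \<phi> :: "'a \<Rightarrow> real"
  assumes w0: "\<And>\<omega>. \<omega> \<in> \<Omega> \<Longrightarrow> 0 \<le> w \<omega>" and w1: "sum w \<Omega> = 1"
    and \<phi>: "\<And>\<omega>. \<omega> \<in> \<Omega> \<Longrightarrow> \<bar>\<phi> \<omega>\<bar> \<le> 1"
    and \<mu>: "\<mu> = (\<Sum>\<omega>\<in>\<Omega>. w \<omega> * \<phi> \<omega>)"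
    and v: "(\<Sum>\<omega>\<in>\<Omega>. w \<omega> * (\<phi> \<omega>)\<^sup>2) \<le> v"
    and s: "\<bar>s\<bar> \<le> 1 / 2"
  shows "(\<Sum>\<omega>\<in>\<Omega>. w \<omega> * exp (s * (\<phi> \<omega> - \<mu>))) \<le> exp (s\<^sup>2 * v)"
proof -
  have "\<bar>\<mu>\<bar> \<le> (\<Sum>\<omega>\<in>\<Omega>. w \<omega> * \<bar>\<phi> \<omega>\<bar>)"
    unfolding \<mu> using w0 by (intro order.trans[OF sum_abs] sum_mono) (auto simp: abs_mult)
  also have "\<dots> \<le> (\<Sum>\<omega>\<in>\<Omega>. w \<omega>)"
    using w0 \<phi> by (intro sum_mono) (simp add: mult_left_le)
  finally have \<mu>1: "\<bar>\<mu>\<bar> \<le> 1" by (simp add: w1)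
  have "(\<Sum>\<omega>\<in>\<Omega>. w \<omega> * exp (s * (\<phi> \<omega> - \<mu>)))
      \<le> (\<Sum>\<omega>\<in>\<Omega>. w \<omega> * (1 + s * (\<phi> \<omega> - \<mu>) + (s * (\<phi> \<omega> - \<mu>))\<^sup>2))"
  proof (intro sum_mono mult_left_mono exp_le_quadratic w0)
    fix \<omega> assume "\<omega> \<in> \<Omega>"
    then have "\<bar>\<phi> \<omega> - \<mu>\<bar> \<le> 2" using \<phi>[of \<omega>] \<mu>1 by linarith
    then have "\<bar>s\<bar> * \<bar>\<phi> \<omega> - \<mu>\<bar> \<le> 1 / 2 * 2" using s by (intro mult_mono) auto
    then show "\<bar>s * (\<phi> \<omega> - \<mu>)\<bar> \<le> 1" by (simp add: abs_mult)
  qed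
  also have "\<dots> = (\<Sum>\<omega>\<in>\<Omega>. w \<omega> * (1 - s * \<mu> + s\<^sup>2 * \<mu>\<^sup>2) + (s - 2 * s\<^sup>2 * \<mu>) * (w \<omega> * \<phi> \<omega>)
                    + s\<^sup>2 * (w \<omega> * (\<phi> \<omega>)\<^sup>2))"
    by (intro sum.cong refl) (simp add: algebra_simps power2_eq_square)
  also have "\<dots> = (1 - s * \<mu> + s\<^sup>2 * \<mu>\<^sup>2) + (s - 2 * s\<^sup>2 * \<mu>) * \<mu>
                    + s\<^sup>2 * (\<Sum>\<omega>\<in>\<Omega>. w \<omega> * (\<phi> \<omega>)\<^sup>2)"
    by (simp add: sum.distrib w1 \<mu> flip: sum_distrib_left sum_distrib_right)
  also have "\<dots> = 1 + s\<^sup>2 * ((\<Sum>\<omega>\<in>\<Omega>. w \<omega> * (\<phi> \<omega>)\<^sup>2) - \<mu>\<^sup>2)"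
    by (simp add: algebra_simps power2_eq_square)
  also have "\<dots> \<le> 1 + s\<^sup>2 * v"
    using v by (intro add_left_mono mult_left_mono) (auto intro: order.trans[rotated])
  also have "\<dots> \<le> exp (s\<^sup>2 * v)" by (rule exp_ge_add_one_self)
  finally show ?thesis .
qed

lemma sample_mean_exp_moment:
  fixes w \<phi> :: "'a \<Rightarrow> real"
  assumes fin: "finite \<Omega>" and w0: "\<And>\<omega>. \<omega> \<in> \<Omega> \<Longrightarrow> 0 \<le> w \<omega>" and w1: "sum w \<Omega> = 1"
    and \<phi>: "\<And>\<omega>. \<omega> \<in> \<Omega> \<Longrightarrow> \<bar>\<phi> \<omega>\<bar> \<le> 1"
    and \<mu>: "\<mu> = (\<Sum>\<omega>\<in>\<Omega>. w \<omega> * \<phi> \<omega>)"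
    and v: "(\<Sum>\<omega>\<in>\<Omega>. w \<omega> * (\<phi> \<omega>)\<^sup>2) \<le> v"
    and s: "\<bar>s\<bar> \<le> 1 / 2" and k: "0 < k"
  shows "(\<Sum>f\<in>PiE {..<k} (\<lambda>_. \<Omega>). (\<Prod>i<k. w (f i)) *
            exp (s * real k * ((\<Sum>i<k. \<phi> (f i)) / real k - \<mu>))) \<le> exp (real k * (s\<^sup>2 * v))"
proof -
  have "s * real k * ((\<Sum>i<k. \<phi> (f i)) / real k - \<mu>) = (\<Sum>i<k. s * (\<phi> (f i) - \<mu>))" for f
    using k by (simp add: sum_subtractf field_simps flip: sum_distrib_left)
  then have "(\<Sum>f\<in>PiE {..<k} (\<lambda>_. \<Omega>). (\<Prod>i<k. w (f i)) *
            exp (s * real k * ((\<Sum>i<k. \<phi> (f i)) / real k - \<mu>)))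
      = (\<Sum>f\<in>PiE {..<k} (\<lambda>_. \<Omega>). (\<Prod>i<k. w (f i)) * (\<Prod>i<k. exp (s * (\<phi> (f i) - \<mu>))))"
    by (simp add: exp_sum)
  also have "\<dots> = (\<Sum>\<omega>\<in>\<Omega>. w \<omega> * exp (s * (\<phi> \<omega> - \<mu>))) ^ k"
    by (rule sum_weighted_tuples[OF fin])
  also have "\<dots> \<le> exp (s\<^sup>2 * v) ^ k"
    by (intro power_mono centred_exp_moment[OF w0 w1 \<phi> \<mu> v s] sum_nonneg) (auto simp: w0)
  also have "\<dots> = exp (real k * (s\<^sup>2 * v))" by (simp add: exp_of_nat_mult)
  finally show ?thesis .
qed

text \<open>
  The bound \<open>E Y\<^sup>2\<^sup>m \<le> 2 (2 m)! (s k)\<^sup>-\<^sup>2\<^sup>m exp (k s\<^sup>2 v)\<close> holds for each \<open>s \<le> 1/2\<close>, and the two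
  summands are the two choices of \<open>s\<close>. The optimal \<open>s\<^sup>2 = m / (k v)\<close> gives Gaussian behaviour, with
  variance \<open>v/k\<close>. When \<open>v\<close> is so small that this \<open>s\<close> exceeds \<open>1/2\<close>, the choice \<open>s = 1/2\<close> gives the
  Poisson-type term.
\<close>
lemma sample_mean_moment:
  fixes w \<phi> :: "'a \<Rightarrow> real"
  assumes fin: "finite \<Omega>" and w0: "\<And>\<omega>. \<omega> \<in> \<Omega> \<Longrightarrow> 0 \<le> w \<omega>" and w1: "sum w \<Omega> = 1"
    and \<phi>: "\<And>\<omega>. \<omega> \<in> \<Omega> \<Longrightarrow> \<bar>\<phi> \<omega>\<bar> \<le> 1"
    and \<mu>: "\<mu> = (\<Sum>\<omega>\<in>\<Omega>. w \<omega> * \<phi> \<omega>)"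
    and v: "(\<Sum>\<omega>\<in>\<Omega>. w \<omega> * (\<phi> \<omega>)\<^sup>2) \<le> v"
    and m: "0 < m" and k: "0 < k" and \<rho>: "real m / real k \<le> \<rho>"
  shows "(\<Sum>f\<in>PiE {..<k} (\<lambda>_. \<Omega>). (\<Prod>i<k. w (f i)) *
            ((\<Sum>i<k. \<phi> (f i)) / real k - \<mu>) ^ (2 * m))
          \<le> 2 * (12 * \<rho> * v) ^ m + 2 * (48 * \<rho>\<^sup>2) ^ m"
    (is "?E \<le> _")
proof -
  define W where "W f = (\<Prod>i<k. w (f i))" for f
  define Y where "Y f = (\<Sum>i<k. \<phi> (f i)) / real k - \<mu>" for f
  let ?P = "PiE {..<k} (\<lambda>_. \<Omega>)"
  have W0: "0 \<le> W f" if "f \<in> ?P" for f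
    unfolding W_def using that by (intro prod_nonneg) (auto intro!: w0 simp: PiE_iff)
  have v0: "0 \<le> v"
    by (rule order.trans[OF sum_nonneg v]) (auto simp: w0)
  have \<rho>0: "0 < \<rho>" using m k \<rho> by (meson divide_pos_pos less_le_trans of_nat_0_less_iff)
  have bound: "?E \<le> 2 * (4 * (real m)\<^sup>2 / (real k * s)\<^sup>2) ^ m * exp (real k * (s\<^sup>2 * v))"
    if s: "0 < s" "s \<le> 1 / 2" for s
  proof -
    define C where "C = fact (2 * m) / (s * real k) ^ (2 * m)"
    have sk: "0 < s * real k" using s k by simp
    have C0: "0 \<le> C" using sk by (simp add: C_def)
    have pt: "Y f ^ (2 * m) \<le> C * (exp (s * real k * Y f) + exp ((- s) * real k * Y f))" for f
    proof -
      have "(s * real k) ^ (2 * m) * Y f ^ (2 * m)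
          \<le> fact (2 * m) * (exp (s * real k * Y f) + exp ((- s) * real k * Y f))"
        using even_power_le_exp_exp[of "s * real k * Y f" m] by (simp add: power_mult_distrib)
      moreover have "0 < (s * real k) ^ (2 * m)" using sk by simp
      ultimately show ?thesis by (simp add: C_def pos_le_divide_eq mult.commute)
    qed
    have "?E \<le> (\<Sum>f\<in>?P. W f * (C * (exp (s * real k * Y f) + exp ((- s) * real k * Y f))))"
      unfolding W_def[symmetric] Y_def[symmetric]
      by (intro sum_mono mult_left_mono pt W0)
    also have "\<dots> = C * ((\<Sum>f\<in>?P. W f * exp (s * real k * Y f)) +
                        (\<Sum>f\<in>?P. W f * exp ((- s) * real k * Y f)))"
      by (simp add: sum.distrib[symmetric] sum_distrib_left algebra_simps)
    also have "\<dots> \<le> C * (exp (real k * (s\<^sup>2 * v)) + exp (real k * ((- s)\<^sup>2 * v)))"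
      unfolding W_def Y_def using s C0
      by (intro mult_left_mono add_mono sample_mean_exp_moment[OF fin w0 w1 \<phi> \<mu> v _ k]) auto
    also have "\<dots> = 2 * C * exp (real k * (s\<^sup>2 * v))" by simp
    also have "C \<le> real (2 * m) ^ (2 * m) / (s * real k) ^ (2 * m)"
      unfolding C_def using sk fact_le_power[of "2 * m", where 'a = real]
      by (intro divide_right_mono) auto
    also have "\<dots> = (4 * (real m)\<^sup>2 / (real k * s)\<^sup>2) ^ m"
    proof -
      have "real (2 * m) ^ (2 * m) / (s * real k) ^ (2 * m) = ((real (2 * m) / (s * real k))\<^sup>2) ^ m"
        by (simp only: power_divide[symmetric] power_mult[symmetric])
      also have "(real (2 * m) / (s * real k))\<^sup>2 = 4 * (real m)\<^sup>2 / (real k * s)\<^sup>2"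
        by (simp add: power_divide power_mult_distrib mult.commute)
      finally show ?thesis .
    qed
    finally show ?thesis by simp
  qed
  have e3: "exp (real m) \<le> 3 ^ m"
    using power_mono[OF exp_le, of m] by (simp add: exp_of_nat_mult[symmetric])
  show ?thesis
  proof (cases "4 * real m \<le> real k * v")
    case True
    then have kv: "0 < real k * v" using m by (simp add: less_le_trans[of 0 "4 * real m"])
    define s where "s = sqrt (real m / (real k * v))"
    have s2: "s\<^sup>2 = real m / (real k * v)" using kv by (simp add: s_def)
    have "s \<le> sqrt (1 / 4)" unfolding s_def using True kv by (intro real_sqrt_le_mono) (simp add: field_simps)
    then have s: "0 < s" "s \<le> 1 / 2" using m kv by (auto simp: s_def real_sqrt_divide)
    have "?E \<le> 2 * (4 * (real m)\<^sup>2 / (real k * s)\<^sup>2) ^ m * exp (real k * (s\<^sup>2 * v))"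
      by (rule bound[OF s])
    also have "4 * (real m)\<^sup>2 / (real k * s)\<^sup>2 = 4 * (real m / real k) * v"
      unfolding power_mult_distrib s2 using m k kv by (simp add: field_simps power2_eq_square)
    also have "real k * (s\<^sup>2 * v) = real m" unfolding s2 using kv by (auto simp: field_simps)
    also have "2 * (4 * (real m / real k) * v) ^ m * exp (real m) \<le> 2 * (4 * \<rho> * v) ^ m * 3 ^ m"
    proof -
      have "4 * (real m / real k) * v \<le> 4 * \<rho> * v"
        using \<rho> v0 by (intro mult_right_mono) auto
      then have "(4 * (real m / real k) * v) ^ m \<le> (4 * \<rho> * v) ^ m"
        using v0 by (intro power_mono) simp_all
      then show ?thesis
        using e3 v0 \<rho>0 by (intro mult_mono) simp_all
    qed
    also have "\<dots> = 2 * (12 * \<rho> * v) ^ m"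
      using power_mult_distrib[of "4 * \<rho> * v" 3 m] by (simp add: mult_ac)
    finally have "?E \<le> 2 * (12 * \<rho> * v) ^ m" .
    moreover have "0 \<le> 2 * (48 * \<rho>\<^sup>2) ^ m" by simp
    ultimately show ?thesis by linarith
  next
    case False
    have "?E \<le> 2 * (4 * (real m)\<^sup>2 / (real k * (1/2))\<^sup>2) ^ m * exp (real k * ((1/2)\<^sup>2 * v))"
      by (rule bound) auto
    also have "4 * (real m)\<^sup>2 / (real k * (1/2))\<^sup>2 = 16 * (real m / real k)\<^sup>2"
      by (simp add: power_divide power_mult_distrib)
    also have "2 * (16 * (real m / real k)\<^sup>2) ^ m * exp (real k * ((1/2)\<^sup>2 * v))
        \<le> 2 * (16 * (real m / real k)\<^sup>2) ^ m * exp (real m)"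
      using False by (intro mult_left_mono) (auto simp: power2_eq_square)
    also have "2 * (16 * (real m / real k)\<^sup>2) ^ m * exp (real m) \<le> 2 * (16 * \<rho>\<^sup>2) ^ m * 3 ^ m"
    proof -
      have "16 * (real m / real k)\<^sup>2 \<le> 16 * \<rho>\<^sup>2"
        using \<rho> by (intro mult_left_mono power_mono) auto
      then have "(16 * (real m / real k)\<^sup>2) ^ m \<le> (16 * \<rho>\<^sup>2) ^ m"
        by (intro power_mono) simp_all
      then show ?thesis
        using e3 by (intro mult_mono) simp_all
    qed
    also have "\<dots> = 2 * (48 * \<rho>\<^sup>2) ^ m"
      using power_mult_distrib[of "16 * \<rho>\<^sup>2" 3 m] by (auto simp: mult_ac)
    finally have "?E \<le> 2 * (48 * \<rho>\<^sup>2) ^ m" .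
    moreover have "0 \<le> 2 * (12 * \<rho> * v) ^ m" using \<rho>0 v0 by simp
    ultimately show ?thesis by linarith
  qed
qed

section \<open>Cyclic functions and power means\<close>

text \<open>
  Functions on the cyclic group of order \<open>M\<close> are represented by
  \<open>M\<close>-periodic functions on the integers, so that translations need no reduction modulo
  \<open>M\<close>.
\<close>
definition cyclic :: "nat \<Rightarrow> (int \<Rightarrow> 'a) \<Rightarrow> bool" where
  "cyclic M f \<longleftrightarrow> (\<forall>x. f (x mod int M) = f x)"

lemma cyclicD: "cyclic M f \<Longrightarrow> x mod int M = y mod int M \<Longrightarrow> f x = f y"
  by (metis cyclic_def)

lemma cyclic_compose_shift: "cyclic M f \<Longrightarrow> cyclic M (\<lambda>x. f (x + t))"
  unfolding cyclic_def[of M "\<lambda>x. f (x + t)"] by (auto intro: cyclicD simp: mod_simps)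

lemma sum_cyclic_shift:
  fixes f :: "int \<Rightarrow> 'a :: comm_monoid_add"
  assumes "M > 0" "cyclic M f"
  shows "(\<Sum>x\<in>{0..<int M}. f (x + t)) = (\<Sum>x\<in>{0..<int M}. f x)"
  by (rule sum.reindex_bij_witness[where i = "\<lambda>y. (y - t) mod int M" and j = "\<lambda>x. (x + t) mod int M"])
    (use assms in \<open>auto simp: mod_simps cyclic_def\<close>)

text \<open>
  Convexity of even powers takes the place of the triangle inequality for power norms throughout.
\<close>
lemma weighted_even_power_mean:
  fixes w y :: "'a \<Rightarrow> real"
  assumes "finite I" "sum w I = 1" "\<And>i. i \<in> I \<Longrightarrow> 0 \<le> w i"
  shows "(\<Sum>i\<in>I. w i * y i) ^ (2 * m) \<le> (\<Sum>i\<in>I. w i * y i ^ (2 * m))"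
proof -
  have "I \<noteq> {}" using assms(2) by auto
  then show ?thesis
    using convex_on_sum[OF assms(1) _ convex_power_even[of "2 * m"] assms(2), of y] assms(3) by simp
qed

lemma even_power_mean:
  fixes y :: "'a \<Rightarrow> real"
  assumes "finite I" "I \<noteq> {}"
  shows "((\<Sum>i\<in>I. y i) / real (card I)) ^ (2 * m) \<le> (\<Sum>i\<in>I. y i ^ (2 * m)) / real (card I)"
  using weighted_even_power_mean[of I "\<lambda>_. 1 / real (card I)" y m] assms
  by (simp add: sum_divide_distrib)

lemma even_power_sum_le:
  fixes y :: "'a \<Rightarrow> real"
  assumes "finite I" "0 < m"
  shows "(\<Sum>i\<in>I. y i) ^ (2 * m) \<le> real (card I) ^ (2 * m - 1) * (\<Sum>i\<in>I. y i ^ (2 * m))"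
proof (cases "I = {}")
  case False
  then have n: "0 < real (card I)" using assms by (simp add: card_gt_0_iff)
  have "real (card I) ^ (2 * m) = real (card I) ^ (2 * m - 1) * real (card I)"
    using assms(2) by (metis mult_pos_pos pos2 power_minus_mult)
  then show ?thesis
    using even_power_mean[OF assms(1) False, of y m] n by (simp add: power_divide field_simps)
qed (use assms in \<open>simp add: zero_power\<close>)

lemma power_sum_add_le:
  fixes f :: "'b \<Rightarrow> 'a \<Rightarrow> real"
  assumes I: "finite I" and m: "0 < m" and V: "\<And>i. i \<in> I \<Longrightarrow> (\<Sum>x\<in>X. f i x ^ (2 * m)) \<le> V"
  shows "(\<Sum>x\<in>X. (\<Sum>i\<in>I. f i x) ^ (2 * m)) \<le> real (card I) ^ (2 * m) * V"
proof -
  have "(\<Sum>x\<in>X. (\<Sum>i\<in>I. f i x) ^ (2 * m))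
      \<le> (\<Sum>x\<in>X. real (card I) ^ (2 * m - 1) * (\<Sum>i\<in>I. f i x ^ (2 * m)))"
    by (intro sum_mono even_power_sum_le[OF I m])
  also have "\<dots> = real (card I) ^ (2 * m - 1) * (\<Sum>i\<in>I. \<Sum>x\<in>X. f i x ^ (2 * m))"
    by (subst sum.swap) (simp flip: sum_distrib_left)
  also have "\<dots> \<le> real (card I) ^ (2 * m - 1) * (\<Sum>i\<in>I. V)"
    by (intro mult_left_mono sum_mono V) auto
  also have "\<dots> = real (card I) ^ (2 * m) * V"
    using m by (simp add: power_eq_if[of _ "2 * m"])
  finally show ?thesis .
qed

lemma even_power_diff_le:
  fixes a b :: real
  shows "(a - b) ^ (2 * m) \<le> 4 ^ m / 2 * (a ^ (2 * m) + b ^ (2 * m))"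
proof -
  have "((a - b) / 2) ^ (2 * m) \<le> (a ^ (2 * m) + b ^ (2 * m)) / 2"
    using even_power_mean[of "{False, True}" "\<lambda>i. if i then a else - b" m] by (simp add: add.commute)
  then have "(a - b) ^ (2 * m) / 4 ^ m \<le> (a ^ (2 * m) + b ^ (2 * m)) / 2"
    unfolding power_divide by (simp add: power_mult)
  then show ?thesis by (simp add: field_simps)
qed

lemma markov_half:
  fixes E :: "'a \<Rightarrow> real"
  assumes "finite P" "\<And>f. f \<in> P \<Longrightarrow> 0 \<le> E f" "(\<Sum>f\<in>P. E f) \<le> V * real (card P)" "0 < V"
  shows "real (card P) \<le> 2 * real (card {f \<in> P. E f \<le> 2 * V})"
proof -
  let ?bad = "{f \<in> P. \<not> E f \<le> 2 * V}"
  have "2 * V * real (card ?bad) = (\<Sum>f\<in>?bad. 2 * V)" by simp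
  also have "\<dots> \<le> (\<Sum>f\<in>?bad. E f)" by (intro sum_mono) auto
  also have "\<dots> \<le> (\<Sum>f\<in>P. E f)" using assms by (intro sum_mono2) auto
  also have "\<dots> \<le> V * real (card P)" by fact
  finally have "2 * real (card ?bad) \<le> real (card P)" using \<open>0 < V\<close> by simp
  moreover have "card P = card {f \<in> P. E f \<le> 2 * V} + card ?bad"
    using assms(1) by (subst card_Un_disjoint[symmetric]) (auto intro: arg_cong[where f = card])
  ultimately show ?thesis by simp
qed

text \<open>
  Pigeonhole over diagonal translates: each of the \<open>M\<close> translates of \<open>G\<close> has as many elements as \<open>G\<close>
  and lies in the set of all tuples, so some tuple lies in at least the average number of them. A
  large set of good samples thus yields a single tuple with many good translates.
\<close>
lemma popular_translate:
  assumes M: "M > 0" and G: "G \<subseteq> PiE {..<k} (\<lambda>_. {0..<int M})"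
  shows "\<exists>c. M * card G
          \<le> M ^ k * card {x \<in> {0..<int M}. (\<lambda>i\<in>{..<k}. (c i - x) mod int M) \<in> G}"
proof (rule ccontr)
  let ?Z = "{0..<int M}"
  let ?Q = "PiE {..<k} (\<lambda>_. ?Z)"
  define T where "T c = {x \<in> ?Z. (\<lambda>i\<in>{..<k}. (c i - x) mod int M) \<in> G}" for c
  define T' where "T' x = {c \<in> ?Q. (\<lambda>i\<in>{..<k}. (c i - x) mod int M) \<in> G}" for x
  assume "\<not> ?thesis"
  then have less: "M ^ k * card (T c) < M * card G" for c by (auto simp: T_def not_le)
  have finQ: "finite ?Q" by (intro finite_PiE) auto
  have cardQ: "card ?Q = M ^ k" by (simp add: card_PiE)
  have ge: "card G \<le> card (T' x)" for x
  proof (rule card_inj_on_le)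
    show "finite (T' x)" using finQ by (simp add: T'_def)
    show "inj_on (\<lambda>g. \<lambda>i\<in>{..<k}. (g i + x) mod int M) G"
    proof (rule inj_onI)
      fix g h assume gh: "g \<in> G" "h \<in> G"
        and eq: "(\<lambda>i\<in>{..<k}. (g i + x) mod int M) = (\<lambda>i\<in>{..<k}. (h i + x) mod int M)"
      have "g i = h i" if "i < k" for i
      proof -
        have "(g i + x) mod int M = (h i + x) mod int M" using fun_cong[OF eq, of i] that by simp
        then have "g i mod int M = h i mod int M"
          by (metis add_diff_cancel_right' mod_diff_left_eq)
        moreover have "g i \<in> ?Z" "h i \<in> ?Z" using gh G that by (auto simp: PiE_iff subset_iff)
        ultimately show ?thesis by simp
      qed
      then show "g = h" using gh G by (intro PiE_ext[of g "{..<k}" "\<lambda>_. ?Z" h]) auto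
    qed
    show "(\<lambda>g. \<lambda>i\<in>{..<k}. (g i + x) mod int M) ` G \<subseteq> T' x"
    proof safe
      fix g assume g: "g \<in> G"
      then have gQ: "g \<in> ?Q" using G by auto
      have "(\<lambda>i\<in>{..<k}. ((\<lambda>i\<in>{..<k}. (g i + x) mod int M) i - x) mod int M) = g"
      proof
        fix i
        show "(\<lambda>i\<in>{..<k}. ((\<lambda>i\<in>{..<k}. (g i + x) mod int M) i - x) mod int M) i = g i"
          using gQ by (cases "i < k") (auto simp: PiE_iff mod_simps extensional_def)
      qed
      then show "(\<lambda>i\<in>{..<k}. (g i + x) mod int M) \<in> T' x"
        using g M by (auto simp: T'_def)
    qed
  qed
  have "M ^ k * (M * card G) = M ^ k * (\<Sum>x\<in>?Z. card G)" by simp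
  also have "\<dots> \<le> M ^ k * (\<Sum>x\<in>?Z. card (T' x))" by (intro mult_left_mono sum_mono ge) auto
  also have "(\<Sum>x\<in>?Z. card (T' x))
      = (\<Sum>x\<in>?Z. \<Sum>c\<in>?Q. of_bool ((\<lambda>i\<in>{..<k}. (c i - x) mod int M) \<in> G))"
    using finQ by (simp add: T'_def Int_def)
  also have "\<dots> = (\<Sum>c\<in>?Q. \<Sum>x\<in>?Z. of_bool ((\<lambda>i\<in>{..<k}. (c i - x) mod int M) \<in> G))"
    by (rule sum.swap)
  also have "\<dots> = (\<Sum>c\<in>?Q. card (T c))" by (simp add: T_def Int_def)
  also have "M ^ k * \<dots> = (\<Sum>c\<in>?Q. M ^ k * card (T c))" by (simp add: sum_distrib_left)
  also have "\<dots> < (\<Sum>c\<in>?Q. M * card G)"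
  proof (rule sum_strict_mono)
    show "?Q \<noteq> {}" using M cardQ by (metis card.empty power_not_zero less_numeral_extra(3))
  qed (use finQ less in auto)
  also have "\<dots> = M ^ k * (M * card G)" by (simp add: cardQ)
  finally show False by simp
qed

text \<open>
  The convolution of the indicator function of \<open>A\<close> with the uniform probability measure
  on \<open>B\<close>, in the cyclic group of order \<open>M\<close>.
\<close>
definition sumset_density :: "nat \<Rightarrow> int set \<Rightarrow> int set \<Rightarrow> int \<Rightarrow> real" where
  "sumset_density M A B x = (\<Sum>b\<in>B. of_bool ((x - b) mod int M \<in> A)) / real (card B)"

lemma cyclic_sumset_density: "cyclic M (sumset_density M A B)"
  by (simp add: cyclic_def sumset_density_def mod_simps)

lemma sumset_density_nonneg: "0 \<le> sumset_density M A B x"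
  by (simp add: sumset_density_def sum_nonneg)

lemma sumset_density_pos:
  assumes "0 < sumset_density M A B x"
  shows "\<exists>a\<in>A. \<exists>b\<in>B. x mod int M = (a + b) mod int M"
proof (rule ccontr)
  assume neg: "\<not> ?thesis"
  have "(x - b) mod int M \<notin> A" if "b \<in> B" for b
    using neg that by (auto dest!: bspec simp: mod_simps)
  then show False using assms by (simp add: sumset_density_def)
qed

lemma sum_sumset_density:
  assumes M: "M > 0" and A: "A \<subseteq> {0..<int M}" and B: "finite B" "B \<noteq> {}"
  shows "(\<Sum>x\<in>{0..<int M}. sumset_density M A B x) = real (card A)"
proof -
  have "(\<Sum>x\<in>{0..<int M}. of_bool ((x - b) mod int M \<in> A)) = real (card A)" for b
  proof -
    have "(\<Sum>x\<in>{0..<int M}. of_bool ((x - b) mod int M \<in> A) :: real)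
        = (\<Sum>x\<in>{0..<int M}. of_bool (x mod int M \<in> A))"
      using sum_cyclic_shift[OF M, of "\<lambda>x. of_bool (x mod int M \<in> A) :: real" "- b"]
      by (simp add: cyclic_def)
    also have "\<dots> = (\<Sum>x\<in>{0..<int M}. of_bool (x \<in> A))" by (intro sum.cong) auto
    also have "\<dots> = real (card A)" using A by (simp add: Int_absorb1)
    finally show ?thesis .
  qed
  then have "(\<Sum>b\<in>B. \<Sum>x\<in>{0..<int M}. of_bool ((x - b) mod int M \<in> A)) = real (card B) * real (card A)"
    by simp
  then show ?thesis
    using B unfolding sumset_density_def
    by (subst (asm) sum.swap) (simp add: field_simps flip: sum_divide_distrib)
qed

lemma sumset_density_power_sum_ge:
  assumes M: "M > 0" and A: "A \<subseteq> {0..<int M}" and B: "finite B" "B \<noteq> {}"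
  shows "real M * (real (card A) / real M) ^ (2 * m)
          \<le> (\<Sum>x\<in>{0..<int M}. sumset_density M A B x ^ (2 * m))"
  using even_power_mean[of "{0..<int M}" "sumset_density M A B" m] M sum_sumset_density[OF assms]
  by (simp add: field_simps)

text \<open>
  Pointwise, \<open>(a f)\<^sup>m\<close> is at most the mean of \<open>f\<^sup>2\<^sup>m\<close> and \<open>a\<^sup>2\<^sup>m\<close>, and the power mean inequality
  makes the second sum no larger than the first when \<open>a\<close> is the mean of \<open>f\<close>. In this way the
  variance bound \<open>F\<close> is absorbed into the power norm of \<open>F\<close> itself.
\<close>
lemma power_sum_mixed_le:
  fixes f :: "'a \<Rightarrow> real"
  assumes "real (card X) * a ^ (2 * m) \<le> (\<Sum>x\<in>X. f x ^ (2 * m))"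
  shows "(\<Sum>x\<in>X. (a * f x) ^ m) \<le> (\<Sum>x\<in>X. f x ^ (2 * m))"
proof -
  have "(a * f x) ^ m \<le> (f x ^ (2 * m) + a ^ (2 * m)) / 2" for x
    using sum_squares_bound[of "f x ^ m" "a ^ m"]
    by (simp add: power_mult_distrib power_mult[symmetric] mult.commute)
  then have "(\<Sum>x\<in>X. (a * f x) ^ m) \<le> (\<Sum>x\<in>X. (f x ^ (2 * m) + a ^ (2 * m)) / 2)"
    by (intro sum_mono)
  also have "\<dots> = ((\<Sum>x\<in>X. f x ^ (2 * m)) + real (card X) * a ^ (2 * m)) / 2"
    by (simp add: sum.distrib flip: sum_divide_distrib)
  also have "\<dots> \<le> (\<Sum>x\<in>X. f x ^ (2 * m))" using assms by simp
  finally show ?thesis .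
qed

section \<open>Almost periods of the sumset density\<close>

text \<open>
  The sampled variables are indicators, so their second moment at \<open>x\<close> is the mean \<open>F(x)\<close> itself. With
  a sample of size \<open>K m / \<alpha>\<close>, where \<open>\<alpha>\<close> is the density of \<open>A\<close>, the moment bound at \<open>x\<close> involves
  \<open>(\<alpha> F(x) / K)\<^sup>m\<close> and \<open>(\<alpha>/K)\<^sup>2\<^sup>m\<close>, and both are dominated on average by the power sum of \<open>F\<close>.
\<close>
lemma sampled_translates_moment:
  fixes K :: real
  assumes M: "M > 0" and A: "A \<subseteq> {0..<int M}" and B: "finite B" "B \<noteq> {}"
    and m: "0 < m" and k: "0 < k" and K: "0 < K"
    and mk: "real m / real k \<le> (real (card A) / real M) / K"
  shows "(\<Sum>f\<in>PiE {..<k} (\<lambda>_. B). \<Sum>x\<in>{0..<int M}.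
            ((\<Sum>i<k. of_bool ((x - f i) mod int M \<in> A)) / real k - sumset_density M A B x) ^ (2 * m))
          \<le> (2 * (12 / K) ^ m + 2 * (48 / K\<^sup>2) ^ m)
              * (\<Sum>x\<in>{0..<int M}. sumset_density M A B x ^ (2 * m)) * real (card B ^ k)"
proof -
  define F where "F = sumset_density M A B"
  define a where "a = real (card A) / real M"
  define S where "S = (\<Sum>x\<in>{0..<int M}. F x ^ (2 * m))"
  define n where "n = real (card B)"
  let ?P = "PiE {..<k} (\<lambda>_. B)"
  let ?d = "\<lambda>f x. (\<Sum>i<k. of_bool ((x - f i) mod int M \<in> A)) / real k - F x"
  have n: "0 < n" using B by (simp add: n_def card_gt_0_iff)
  have S: "real M * a ^ (2 * m) \<le> S"
    unfolding a_def S_def F_def by (rule sumset_density_power_sum_ge[OF M A B])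
  have Sm: "(\<Sum>x\<in>{0..<int M}. (a * F x) ^ m) \<le> S"
    using S unfolding S_def by (intro power_sum_mixed_le) simp
  (* For indicators the second moment equals the mean, so the moment bound applies with v = F x. *)
  have pt: "(\<Sum>f\<in>?P. (1 / n) ^ k * ?d f x ^ (2 * m))
      \<le> 2 * (12 / K) ^ m * (a * F x) ^ m + 2 * (48 / K\<^sup>2) ^ m * a ^ (2 * m)" for x
  proof -
    have mean: "F x = (\<Sum>b\<in>B. 1 / n * of_bool ((x - b) mod int M \<in> A))"
      by (simp add: F_def sumset_density_def n_def sum_divide_distrib)
    have "(\<Sum>f\<in>?P. (\<Prod>i<k. 1 / n) * ?d f x ^ (2 * m))
        \<le> 2 * (12 * (a / K) * F x) ^ m + 2 * (48 * (a / K)\<^sup>2) ^ m"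
    proof (rule sample_mean_moment[OF B(1) _ _ _ mean])
      show "sum (\<lambda>_. 1 / n) B = 1" using B by (simp add: n_def)
      show "(\<Sum>b\<in>B. 1 / n * (of_bool ((x - b) mod int M \<in> A))\<^sup>2) \<le> F x"
        unfolding mean by (intro sum_mono) (auto simp: of_bool_def)
    qed (use n m k mk in \<open>auto simp: a_def\<close>)
    also have "12 * (a / K) * F x = 12 / K * (a * F x)" by simp
    also have "48 * (a / K)\<^sup>2 = 48 / K\<^sup>2 * a\<^sup>2" by (simp add: power_divide)
    finally show ?thesis
      unfolding power_mult_distrib[of "12 / K"] power_mult_distrib[of "48 / K\<^sup>2"]
      by (simp add: power_mult)
  qed
  have "(1 / n) ^ k * (\<Sum>f\<in>?P. \<Sum>x\<in>{0..<int M}. ?d f x ^ (2 * m))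
      = (\<Sum>x\<in>{0..<int M}. \<Sum>f\<in>?P. (1 / n) ^ k * ?d f x ^ (2 * m))"
    by (subst sum.swap) (simp add: sum_distrib_left)
  also have "\<dots> \<le> (\<Sum>x\<in>{0..<int M}.
      2 * (12 / K) ^ m * (a * F x) ^ m + 2 * (48 / K\<^sup>2) ^ m * a ^ (2 * m))"
    by (intro sum_mono pt)
  also have "\<dots> = 2 * (12 / K) ^ m * (\<Sum>x\<in>{0..<int M}. (a * F x) ^ m)
      + 2 * (48 / K\<^sup>2) ^ m * (real M * a ^ (2 * m))"
    by (simp add: sum.distrib flip: sum_distrib_left)
  also have "\<dots> \<le> 2 * (12 / K) ^ m * S + 2 * (48 / K\<^sup>2) ^ m * S"
    using K by (intro add_mono mult_left_mono Sm S) auto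
  finally have "(1 / n) ^ k * (\<Sum>f\<in>?P. \<Sum>x\<in>{0..<int M}. ?d f x ^ (2 * m))
      \<le> (2 * (12 / K) ^ m + 2 * (48 / K\<^sup>2) ^ m) * S"
    by (simp add: algebra_simps)
  then show ?thesis using n
    by (simp add: F_def S_def power_divide pos_divide_le_eq flip: n_def)
qed

text \<open>
  If the sample \<open>c - u\<close> is good then the empirical average \<open>g\<close> belonging to \<open>c\<close> is close to the
  translate of \<open>F\<close> by \<open>u\<close>. Hence two good shifts \<open>u\<close> and \<open>v\<close> of the same tuple make the translates of
  \<open>F\<close> by \<open>u\<close> and by \<open>v\<close> close to each other. The set \<open>T\<close> consists of the good shifts of a popular tuple.
\<close>
lemma almost_periods:
  fixes K :: real
  assumes M: "M > 0" and A: "A \<subseteq> {0..<int M}" "A \<noteq> {}" and B: "B \<subseteq> {0..<int M}" "B \<noteq> {}"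
    and m: "0 < m" and k: "0 < k" and K: "0 < K"
    and mk: "real m / real k \<le> (real (card A) / real M) / K"
  obtains T where "T \<subseteq> {0..<int M}" "M * card B ^ k \<le> 2 * (M ^ k * card T)"
    and "\<And>u v. u \<in> T \<Longrightarrow> v \<in> T \<Longrightarrow>
      (\<Sum>x\<in>{0..<int M}. (sumset_density M A B (x + u - v) - sumset_density M A B x) ^ (2 * m))
        \<le> 4 ^ m * 2 * (2 * (12 / K) ^ m + 2 * (48 / K\<^sup>2) ^ m)
            * (\<Sum>x\<in>{0..<int M}. sumset_density M A B x ^ (2 * m))"
proof -
  define F where "F = sumset_density M A B"
  define V where "V = (2 * (12 / K) ^ m + 2 * (48 / K\<^sup>2) ^ m) * (\<Sum>x\<in>{0..<int M}. F x ^ (2 * m))"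
  define E where "E f = (\<Sum>x\<in>{0..<int M}.
      ((\<Sum>i<k. of_bool ((x - f i) mod int M \<in> A)) / real k - F x) ^ (2 * m))" for f
  let ?Z = "{0..<int M}"
  let ?P = "PiE {..<k} (\<lambda>_. B)"
  have finB: "finite B" using finite_subset[OF B(1)] by simp
  have finA: "finite A" using finite_subset[OF A(1)] by simp
  have cF: "cyclic M F" by (simp add: F_def cyclic_sumset_density)
  have "0 < real M * (real (card A) / real M) ^ (2 * m)" using M A finA by (simp add: card_gt_0_iff)
  also have "\<dots> \<le> (\<Sum>x\<in>?Z. F x ^ (2 * m))"
    unfolding F_def using A B finB M by (intro sumset_density_power_sum_ge)
  finally have V0: "0 < V" using K by (simp add: V_def add_pos_pos)
  define G where "G = {f \<in> ?P. E f \<le> 2 * V}"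
  have cardP: "card ?P = card B ^ k" by (simp add: card_PiE)
  have "real (card ?P) \<le> 2 * real (card G)"
    unfolding G_def
  proof (rule markov_half[OF _ _ _ V0])
    show "finite ?P" using finB by (intro finite_PiE) auto
    show "0 \<le> E f" for f by (simp add: E_def sum_nonneg)
    show "sum E ?P \<le> V * real (card ?P)"
      unfolding E_def V_def F_def cardP
      using sampled_translates_moment[OF M A(1) finB B(2) m k K mk] by simp
  qed
  then have G_large: "card B ^ k \<le> 2 * card G" unfolding cardP by linarith
  have "?P \<subseteq> PiE {..<k} (\<lambda>_. ?Z)" using B by (intro PiE_mono) auto
  then have "G \<subseteq> PiE {..<k} (\<lambda>_. ?Z)" by (auto simp: G_def)
  from popular_translate[OF M this] obtain c where
    c: "M * card G \<le> M ^ k * card {x \<in> ?Z. (\<lambda>i\<in>{..<k}. (c i - x) mod int M) \<in> G}" by blast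
  define T where "T = {x \<in> ?Z. (\<lambda>i\<in>{..<k}. (c i - x) mod int M) \<in> G}"
  define g where "g x = (\<Sum>i<k. of_bool ((x - c i) mod int M \<in> A)) / real k" for x
  have cg: "cyclic M g" by (simp add: cyclic_def g_def mod_simps)
  (* Sampling at the shifted tuple c - u means comparing g, translated by u, with F. *)
  have near: "(\<Sum>x\<in>?Z. (g x - F (x - u)) ^ (2 * m)) \<le> 2 * V" if "u \<in> T" for u
  proof -
    let ?f = "\<lambda>i\<in>{..<k}. (c i - u) mod int M"
    have "(\<Sum>i<k. of_bool ((x - ?f i) mod int M \<in> A)) = (\<Sum>i<k. of_bool ((x + u - c i) mod int M \<in> A) :: real)"
      for x by (intro sum.cong refl) (simp add: mod_simps algebra_simps)
    then have "E ?f = (\<Sum>x\<in>?Z. (g (x + u) - F x) ^ (2 * m))"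
      by (simp add: E_def g_def)
    also have "\<dots> = (\<Sum>x\<in>?Z. (g x - F (x - u)) ^ (2 * m))"
    proof -
      have "cyclic M (\<lambda>x. (g x - F (x - u)) ^ (2 * m))"
        using cg cyclic_compose_shift[OF cF, of "- u"] by (simp add: cyclic_def)
      from sum_cyclic_shift[OF M this, of u] show ?thesis by simp
    qed
    finally show ?thesis using that by (simp add: T_def G_def)
  qed
  show ?thesis
  proof (rule that[of T])
    show "T \<subseteq> ?Z" by (auto simp: T_def)
    have "M * card B ^ k \<le> M * (2 * card G)" using G_large by simp
    also have "\<dots> \<le> 2 * (M ^ k * card T)" using c by (simp add: T_def)
    finally show "M * card B ^ k \<le> 2 * (M ^ k * card T)" .
    fix u v assume uv: "u \<in> T" "v \<in> T"
    have "(\<Sum>x\<in>?Z. (F (x + u - v) - F x) ^ (2 * m)) = (\<Sum>x\<in>?Z. (F (x - v) - F (x - u)) ^ (2 * m))"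
    proof -
      have "cyclic M (\<lambda>x. (F (x - v) - F (x - u)) ^ (2 * m))"
        using cyclic_compose_shift[OF cF, of "- u"] cyclic_compose_shift[OF cF, of "- v"]
        by (simp add: cyclic_def)
      from sum_cyclic_shift[OF M this, of u] show ?thesis by simp
    qed
    also have "\<dots> = (\<Sum>x\<in>?Z. ((g x - F (x - u)) - (g x - F (x - v))) ^ (2 * m))" by simp
    also have "\<dots> \<le> (\<Sum>x\<in>?Z. 4 ^ m / 2 * ((g x - F (x - u)) ^ (2 * m) + (g x - F (x - v)) ^ (2 * m)))"
      by (intro sum_mono even_power_diff_le)
    also have "\<dots> = 4 ^ m / 2 * ((\<Sum>x\<in>?Z. (g x - F (x - u)) ^ (2 * m)) + (\<Sum>x\<in>?Z. (g x - F (x - v)) ^ (2 * m)))"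
      by (simp only: sum.distrib sum_distrib_left[symmetric])
    also have "\<dots> \<le> 4 ^ m / 2 * (2 * V + 2 * V)"
      using uv by (intro mult_left_mono add_mono near) auto
    finally show "(\<Sum>x\<in>?Z. (sumset_density M A B (x + u - v) - sumset_density M A B x) ^ (2 * m))
        \<le> 4 ^ m * 2 * (2 * (12 / K) ^ m + 2 * (48 / K\<^sup>2) ^ m)
            * (\<Sum>x\<in>?Z. sumset_density M A B x ^ (2 * m))"
      by (simp add: V_def F_def mult_ac)
  qed
qed

text \<open>
  Convolution with the uniform measures on \<open>T\<close> and on \<open>-T\<close>. Using both
  makes the Fourier multiplier \<open>|\<tau>|\<^sup>2\<close> real and nonnegative.
\<close>
definition difference_average :: "int set \<Rightarrow> (int \<Rightarrow> real) \<Rightarrow> int \<Rightarrow> real" where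
  "difference_average T f x = (\<Sum>p\<in>T \<times> T. f (x + fst p - snd p)) / real (card (T \<times> T))"

lemma cyclic_difference_average:
  assumes "cyclic M f" shows "cyclic M (difference_average T f)"
  unfolding cyclic_def difference_average_def
  by (intro allI arg_cong2[where f = "(/)"] sum.cong refl cyclicD[OF assms])
    (metis add_diff_eq mod_add_left_eq)

lemma cyclic_difference_average_iterate:
  "cyclic M f \<Longrightarrow> cyclic M ((difference_average T ^^ l) f)"
  by (induction l) (auto intro: cyclic_difference_average)

lemma average_power_sum_le:
  fixes h :: "'a \<Rightarrow> int \<Rightarrow> real"
  assumes "finite P" "P \<noteq> {}" "\<And>p. p \<in> P \<Longrightarrow> (\<Sum>x\<in>X. h p x ^ (2 * m)) \<le> E"
  shows "(\<Sum>x\<in>X. ((\<Sum>p\<in>P. h p x) / real (card P)) ^ (2 * m)) \<le> E"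
proof -
  have "(\<Sum>x\<in>X. ((\<Sum>p\<in>P. h p x) / real (card P)) ^ (2 * m))
      \<le> (\<Sum>x\<in>X. (\<Sum>p\<in>P. h p x ^ (2 * m)) / real (card P))"
    by (intro sum_mono even_power_mean assms)
  also have "\<dots> = (\<Sum>p\<in>P. \<Sum>x\<in>X. h p x ^ (2 * m)) / real (card P)"
    by (subst sum.swap) (simp flip: sum_divide_distrib)
  also have "\<dots> \<le> (\<Sum>p\<in>P. E) / real (card P)"
    by (intro divide_right_mono sum_mono assms) auto
  also have "\<dots> = E" using assms by simp
  finally show ?thesis .
qed

text \<open>
  Averaging is a contraction for power sums, so each further average moves the function by no more
  than the first one did, and \<open>l\<close> steps cost at most a factor \<open>l\<close> in the norm.
\<close>
lemma difference_average_iterate_close: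
  assumes M: "M > 0" and F: "cyclic M F" and T: "finite T" "T \<noteq> {}" and m: "0 < m"
    and E: "\<And>u v. u \<in> T \<Longrightarrow> v \<in> T \<Longrightarrow>
      (\<Sum>x\<in>{0..<int M}. (F (x + u - v) - F x) ^ (2 * m)) \<le> E"
  shows "(\<Sum>x\<in>{0..<int M}. ((difference_average T ^^ l) F x - F x) ^ (2 * m)) \<le> real l ^ (2 * m) * E"
proof -
  define H where "H i = (difference_average T ^^ i) F" for i
  define D where "D i x = H (Suc i) x - H i x" for i x
  let ?n = "real (card (T \<times> T))"
  let ?Z = "{0..<int M}"
  have T2: "finite (T \<times> T)" "T \<times> T \<noteq> {}" using T by auto
  have n: "?n \<noteq> 0" using T by simp
  have cH: "cyclic M (H i)" for i unfolding H_def by (rule cyclic_difference_average_iterate[OF F])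
  have cD: "cyclic M (D i)" for i using cH[of i] cH[of "Suc i"] by (simp add: cyclic_def D_def)
  have step: "(\<Sum>x\<in>?Z. D i x ^ (2 * m)) \<le> E" for i
  proof (induction i)
    case 0
    have "D 0 x = (\<Sum>p\<in>T \<times> T. F (x + fst p - snd p) - F x) / ?n" for x
      using n unfolding sum_subtractf diff_divide_distrib
      by (simp add: D_def H_def difference_average_def del: card_cartesian_product)
    then show ?case
      by (simp only:) (intro average_power_sum_le[OF T2] E, auto)
  next
    case (Suc i)
    have "D (Suc i) x = (\<Sum>p\<in>T \<times> T. D i (x + fst p - snd p)) / ?n" for x
      by (simp add: D_def H_def difference_average_def sum_subtractf diff_divide_distrib
          del: card_cartesian_product)
    moreover have "(\<Sum>x\<in>?Z. D i (x + fst p - snd p) ^ (2 * m)) \<le> E" for p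
    proof -
      have "cyclic M (\<lambda>x. D i x ^ (2 * m))" using cD[of i] by (simp add: cyclic_def)
      from sum_cyclic_shift[OF M this, of "fst p - snd p"] Suc.IH show ?thesis
        by (simp add: algebra_simps)
    qed
    ultimately show ?case
      by (simp only:) (intro average_power_sum_le[OF T2])
  qed
  have "H l x - F x = (\<Sum>i<l. D i x)" for x
    using sum_lessThan_telescope[of "\<lambda>i. H i x" l] by (simp add: D_def H_def)
  then have "(\<Sum>x\<in>?Z. (H l x - F x) ^ (2 * m)) = (\<Sum>x\<in>?Z. (\<Sum>i<l. D i x) ^ (2 * m))"
    by simp
  also have "\<dots> \<le> real (card {..<l}) ^ (2 * m) * E"
    by (intro power_sum_add_le m step) auto
  finally show ?thesis by (simp add: H_def)
qed

section \<open>Characters and Chang's theorem\<close>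

definition echar :: "nat \<Rightarrow> int \<Rightarrow> complex" where
  "echar M n = cis (2 * pi * (of_int n / of_nat M))"

lemma norm_echar [simp]: "norm (echar M n) = 1"
  by (simp add: echar_def)

lemma echar_0 [simp]: "echar M 0 = 1"
  by (simp add: echar_def)

lemma echar_add: "echar M (a + b) = echar M a * echar M b"
  by (simp add: echar_def cis_mult add_divide_distrib distrib_left)

lemma echar_minus: "echar M (- a) = cnj (echar M a)"
  by (simp add: echar_def cis_cnj)

lemma echar_diff: "echar M (a - b) = echar M a * cnj (echar M b)"
  using echar_add[of M a "- b"] by (simp add: echar_minus)

lemma echar_sum: "echar M (\<Sum>i\<in>I. f i) = (\<Prod>i\<in>I. echar M (f i))"
  by (induction I rule: infinite_finite_induct) (auto simp: echar_add)

lemma echar_eq_1_iff: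
  assumes "M > 0"
  shows "echar M n = 1 \<longleftrightarrow> int M dvd n"
proof -
  have "echar M n = 1 \<longleftrightarrow> cos (2 * pi * (real_of_int n / real M)) = 1"
    by (auto simp: echar_def complex_eq_iff cos_one_sin_zero)
  also have "\<dots> \<longleftrightarrow> (\<exists>k::int. real_of_int n / real M = of_int k)"
  proof -
    have "2 * pi * y = of_int k * 2 * pi \<longleftrightarrow> y = of_int k" for y :: real and k :: int
    proof -
      have "of_int k * 2 * pi = 2 * pi * of_int k" by simp
      then show ?thesis by (simp only: mult_cancel_left) simp
    qed
    then show ?thesis unfolding cos_one_2pi_int by (simp only:)
  qed
  also have "\<dots> \<longleftrightarrow> (\<exists>k::int. real_of_int n = of_int (int M * k))"
    using assms by (simp add: field_simps)
  also have "\<dots> \<longleftrightarrow> int M dvd n"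
    unfolding of_int_eq_iff by (auto simp: dvd_def)
  finally show ?thesis .
qed

lemma echar_cong:
  assumes "M > 0" "a mod int M = b mod int M"
  shows "echar M a = echar M b"
proof -
  have "echar M (a - b) = 1" using assms by (simp add: echar_eq_1_iff mod_eq_dvd_iff)
  then show ?thesis using echar_add[of M "a - b" b] by simp
qed

lemma echar_orthogonality:
  assumes M: "M > 0"
  shows "(\<Sum>x\<in>{0..<int M}. echar M (n * x)) = (if int M dvd n then of_nat M else 0)"
proof (cases "int M dvd n")
  case True
  then have "echar M (n * x) = 1" for x using M by (simp add: echar_eq_1_iff)
  then show ?thesis using True by simp
next
  case False
  let ?S = "\<Sum>x\<in>{0..<int M}. echar M (n * x)"
  have "cyclic M (\<lambda>x. echar M (n * x))"
    unfolding cyclic_def by (intro allI echar_cong[OF M]) (simp add: mod_simps)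
  from sum_cyclic_shift[OF M this, of 1] have "?S = ?S * echar M n"
    by (simp add: distrib_left echar_add sum_distrib_right)
  then show ?thesis using False M by (simp add: echar_eq_1_iff)
qed

definition dissociated :: "nat \<Rightarrow> int set \<Rightarrow> bool" where
  "dissociated M \<Lambda> \<longleftrightarrow> (\<forall>\<epsilon>. (\<forall>\<gamma>\<in>\<Lambda>. \<epsilon> \<gamma> \<in> {-1, 0, 1}) \<longrightarrow>
      int M dvd (\<Sum>\<gamma>\<in>\<Lambda>. \<epsilon> \<gamma> * \<gamma>) \<longrightarrow> (\<forall>\<gamma>\<in>\<Lambda>. \<epsilon> \<gamma> = 0))"

text \<open>
  Expanding the product gives one character for each choice of coefficients in \<open>{-1, 0, 1}\<close>.
  Dissociativity says that only the zero choice gives the trivial character, so only the constant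
  term survives the summation over the group.
\<close>
lemma riesz_product_sum:
  assumes M: "M > 0" and fin: "finite \<Lambda>" and diss: "dissociated M \<Lambda>"
  shows "(\<Sum>x\<in>{0..<int M}. \<Prod>\<gamma>\<in>\<Lambda>. C + Re (\<omega> \<gamma> * echar M (\<gamma> * x))) = real M * C ^ card \<Lambda>"
proof -
  define \<kappa> :: "int \<Rightarrow> int \<Rightarrow> complex" where
    "\<kappa> \<gamma> e = (if e = 0 then of_real C else if e = 1 then \<omega> \<gamma> / 2 else cnj (\<omega> \<gamma>) / 2)" for \<gamma> e
  let ?P = "PiE \<Lambda> (\<lambda>_. {-1, 0, 1 :: int})"
  let ?zero = "\<lambda>\<gamma>\<in>\<Lambda>. (0 :: int)"
  have factor: "complex_of_real (C + Re (\<omega> \<gamma> * echar M (\<gamma> * x)))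
      = (\<Sum>e\<in>{-1, 0, 1}. \<kappa> \<gamma> e * echar M (e * \<gamma> * x))" for \<gamma> x
    by (simp add: \<kappa>_def echar_minus complex_eq_iff field_simps)
  have sums: "(\<Sum>x\<in>{0..<int M}. echar M ((\<Sum>\<gamma>\<in>\<Lambda>. f \<gamma> * \<gamma>) * x)) = (if f = ?zero then of_nat M else 0)"
    if f: "f \<in> ?P" for f
  proof -
    have "int M dvd (\<Sum>\<gamma>\<in>\<Lambda>. f \<gamma> * \<gamma>) \<longleftrightarrow> f = ?zero"
    proof
      assume "int M dvd (\<Sum>\<gamma>\<in>\<Lambda>. f \<gamma> * \<gamma>)"
      then have "\<forall>\<gamma>\<in>\<Lambda>. f \<gamma> = 0" using diss f unfolding dissociated_def by (auto simp: PiE_iff)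
      then show "f = ?zero" using f by (intro PiE_ext[of f \<Lambda> "\<lambda>_. {-1, 0, 1}"]) auto
    qed simp
    then show ?thesis by (simp add: echar_orthogonality[OF M])
  qed
  have "complex_of_real (\<Sum>x\<in>{0..<int M}. \<Prod>\<gamma>\<in>\<Lambda>. C + Re (\<omega> \<gamma> * echar M (\<gamma> * x)))
      = (\<Sum>x\<in>{0..<int M}. \<Prod>\<gamma>\<in>\<Lambda>. \<Sum>e\<in>{-1, 0, 1}. \<kappa> \<gamma> e * echar M (e * \<gamma> * x))"
    unfolding of_real_sum of_real_prod factor ..
  also have "\<dots> = (\<Sum>x\<in>{0..<int M}. \<Sum>f\<in>?P. \<Prod>\<gamma>\<in>\<Lambda>. \<kappa> \<gamma> (f \<gamma>) * echar M (f \<gamma> * \<gamma> * x))"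
    by (subst prod_sum_PiE[OF fin]) auto
  also have "\<dots> = (\<Sum>f\<in>?P. \<Sum>x\<in>{0..<int M}.
      (\<Prod>\<gamma>\<in>\<Lambda>. \<kappa> \<gamma> (f \<gamma>)) * echar M ((\<Sum>\<gamma>\<in>\<Lambda>. f \<gamma> * \<gamma>) * x))"
    by (subst sum.swap) (simp add: prod.distrib echar_sum sum_distrib_right)
  also have "\<dots> = (\<Sum>f\<in>?P. (\<Prod>\<gamma>\<in>\<Lambda>. \<kappa> \<gamma> (f \<gamma>)) * (if f = ?zero then of_nat M else 0))"
    by (intro sum.cong refl) (simp only: sum_distrib_left[symmetric] sums)
  also have "\<dots> = (\<Sum>f\<in>?P. if f = ?zero then (\<Prod>\<gamma>\<in>\<Lambda>. \<kappa> \<gamma> (?zero \<gamma>)) * of_nat M else 0)"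
    by (intro sum.cong refl) auto
  also have "\<dots> = (\<Prod>\<gamma>\<in>\<Lambda>. \<kappa> \<gamma> (?zero \<gamma>)) * of_nat M"
    using fin by (subst sum.delta) (auto intro: finite_PiE)
  also have "\<dots> = complex_of_real (real M * C ^ card \<Lambda>)"
    by (simp add: \<kappa>_def)
  finally show ?thesis by (simp only: of_real_eq_iff)
qed

text \<open>
  The chord of the exponential between \<open>-s\<close> and \<open>s\<close> lies above its graph.
\<close>
lemma exp_le_cosh_sinh:
  fixes s y :: real
  assumes "\<bar>y\<bar> \<le> 1"
  shows "exp (s * y) \<le> cosh s + y * sinh s"
proof -
  have "exp ((1 - (1 + y) / 2) *\<^sub>R (- s) + ((1 + y) / 2) *\<^sub>R s)
      \<le> (1 - (1 + y) / 2) * exp (- s) + (1 + y) / 2 * exp s"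
    using assms by (intro convex_onD[OF exp_convex]) auto
  also have "(1 - (1 + y) / 2) *\<^sub>R (- s) + ((1 + y) / 2) *\<^sub>R s = s * y"
    by (simp add: field_simps)
  finally show ?thesis by (simp add: cosh_def sinh_def field_simps)
qed

lemma cosh_le_exp_square:
  fixes s :: real
  assumes "\<bar>s\<bar> \<le> 1" shows "cosh s \<le> exp (s\<^sup>2)"
proof -
  have "cosh s \<le> 1 + s\<^sup>2"
    using exp_le_quadratic[of s] exp_le_quadratic[of "- s"] assms by (simp add: cosh_def)
  also have "\<dots> \<le> exp (s\<^sup>2)" by (rule exp_ge_add_one_self)
  finally show ?thesis .
qed

text \<open>
  The transform of the uniform probability measure on \<open>T\<close>.
\<close>
definition set_transform :: "nat \<Rightarrow> int set \<Rightarrow> int \<Rightarrow> complex" where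
  "set_transform M T r = (\<Sum>u\<in>T. echar M (r * u)) / of_nat (card T)"

text \<open>
  Align the phases so that \<open>h\<close>, a sum of \<open>|\<Lambda>|\<close> cosines, has mean at least \<open>|\<Lambda>| / 2\<close> on \<open>T\<close>. By
  Jensen's inequality the mean of \<open>exp (s h)\<close> on \<open>T\<close> is at least \<open>exp (s |\<Lambda>| / 2)\<close>. On the whole group,
  however, a Riesz product bounds the mean of \<open>exp (s h)\<close> by \<open>exp (s\<^sup>2 |\<Lambda>|)\<close>. Comparing the two loses only
  the factor \<open>M / |T|\<close>.
\<close>
lemma chang_dissociated:
  assumes M: "M > 0" and T: "T \<subseteq> {0..<int M}" "T \<noteq> {}"
    and fin: "finite \<Lambda>" and diss: "dissociated M \<Lambda>"
    and large: "\<And>\<gamma>. \<gamma> \<in> \<Lambda> \<Longrightarrow> 1 / 2 \<le> norm (set_transform M T \<gamma>)"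
  shows "real (card \<Lambda>) \<le> 16 * ln (real M / real (card T))"
proof -
  define \<omega> where "\<omega> \<gamma> = cnj (sgn (set_transform M T \<gamma>))" for \<gamma>
  define h where "h x = (\<Sum>\<gamma>\<in>\<Lambda>. Re (\<omega> \<gamma> * echar M (\<gamma> * x)))" for x
  (* Any s with s / 2 > s^2 would do; s = 1/4 maximises the difference. *)
  define s :: real where "s = 1 / 4"
  let ?t = "real (card T)" and ?L = "real (card \<Lambda>)"
  have finT: "finite T" using finite_subset[OF T(1)] by simp
  have t: "0 < ?t" using finT T by (simp add: card_gt_0_iff)
  have \<omega>1: "norm (\<omega> \<gamma>) \<le> 1" for \<gamma> by (simp add: \<omega>_def norm_sgn)
  have corr: "1 / 2 \<le> (\<Sum>x\<in>T. Re (\<omega> \<gamma> * echar M (\<gamma> * x))) / ?t" if "\<gamma> \<in> \<Lambda>" for \<gamma>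
  proof -
    have "(\<Sum>x\<in>T. Re (\<omega> \<gamma> * echar M (\<gamma> * x))) / ?t = Re (\<omega> \<gamma> * set_transform M T \<gamma>)"
      unfolding set_transform_def by (simp add: Re_divide_of_nat sum_distrib_left)
    also have "\<omega> \<gamma> * set_transform M T \<gamma> = of_real (norm (set_transform M T \<gamma>))"
      by (simp add: \<omega>_def sgn_eq mult.commute flip: complex_norm_square)
         (simp add: power2_eq_square)
    finally show ?thesis using large[OF that] by simp
  qed
  have "?L / 2 = (\<Sum>\<gamma>\<in>\<Lambda>. 1 / 2)" by simp
  also have "\<dots> \<le> (\<Sum>\<gamma>\<in>\<Lambda>. (\<Sum>x\<in>T. Re (\<omega> \<gamma> * echar M (\<gamma> * x))) / ?t)"
    by (intro sum_mono corr)
  also have "\<dots> = (\<Sum>x\<in>T. h x) / ?t"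
    unfolding h_def by (subst sum.swap) (simp add: sum_divide_distrib)
  finally have mean: "?L / 2 \<le> (\<Sum>x\<in>T. h x) / ?t" .
  have "exp (s * (?L / 2)) \<le> exp (\<Sum>x\<in>T. (1 / ?t) *\<^sub>R (s * h x))"
    using mean by (simp add: s_def field_simps flip: sum_distrib_left sum_divide_distrib)
  also have "\<dots> \<le> (\<Sum>x\<in>T. 1 / ?t * exp (s * h x))"
    using t T finT by (intro convex_on_sum[OF _ _ exp_convex]) auto
  also have "\<dots> = (\<Sum>x\<in>T. exp (s * h x)) / ?t" by (simp add: sum_divide_distrib)
  finally have "exp (s * (?L / 2)) * ?t \<le> (\<Sum>x\<in>T. exp (s * h x))"
    using t by (simp add: pos_le_divide_eq)
  also have "\<dots> \<le> (\<Sum>x\<in>{0..<int M}. exp (s * h x))"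
    using T by (intro sum_mono2) auto
  also have "(\<Sum>x\<in>{0..<int M}. exp (s * h x))
      \<le> (\<Sum>x\<in>{0..<int M}. \<Prod>\<gamma>\<in>\<Lambda>. cosh s + Re (of_real (sinh s) * \<omega> \<gamma> * echar M (\<gamma> * x)))"
  proof (rule sum_mono)
    fix x
    have "exp (s * h x) = (\<Prod>\<gamma>\<in>\<Lambda>. exp (s * Re (\<omega> \<gamma> * echar M (\<gamma> * x))))"
      using fin by (simp add: h_def sum_distrib_left exp_sum)
    also have "\<dots> \<le> (\<Prod>\<gamma>\<in>\<Lambda>. cosh s + Re (of_real (sinh s) * \<omega> \<gamma> * echar M (\<gamma> * x)))"
    proof (intro prod_mono conjI)
      fix \<gamma>
      have "\<bar>Re (\<omega> \<gamma> * echar M (\<gamma> * x))\<bar> \<le> 1"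
        using abs_Re_le_cmod[of "\<omega> \<gamma> * echar M (\<gamma> * x)"] \<omega>1[of \<gamma>] by (simp add: norm_mult)
      from exp_le_cosh_sinh[OF this, of s]
      show "exp (s * Re (\<omega> \<gamma> * echar M (\<gamma> * x))) \<le> cosh s + Re (of_real (sinh s) * \<omega> \<gamma> * echar M (\<gamma> * x))"
        by (simp add: algebra_simps)
    qed auto
    finally show "exp (s * h x) \<le> (\<Prod>\<gamma>\<in>\<Lambda>. cosh s + Re (of_real (sinh s) * \<omega> \<gamma> * echar M (\<gamma> * x)))" .
  qed
  also have "\<dots> = real M * cosh s ^ card \<Lambda>"
    by (rule riesz_product_sum[OF M fin diss])
  also have "\<dots> \<le> real M * exp (s\<^sup>2) ^ card \<Lambda>"
    by (intro mult_left_mono power_mono cosh_le_exp_square) (auto simp: s_def)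
  also have "\<dots> = real M * exp (s\<^sup>2 * ?L)"
    by (simp only: exp_of_nat_mult[symmetric] mult.commute)
  finally have "exp (s * (?L / 2)) \<le> real M / ?t * exp (s\<^sup>2 * ?L)"
    using t by (simp add: pos_le_divide_eq)
  then have "ln (exp (s * (?L / 2))) \<le> ln (real M / ?t * exp (s\<^sup>2 * ?L))"
    using M t by (subst ln_le_cancel_iff) auto
  also have "\<dots> = ln (real M / ?t) + s\<^sup>2 * ?L"
    using M t by (subst ln_mult_pos) auto
  finally show ?thesis by (simp add: s_def power2_eq_square)
qed

text \<open>
  A maximal dissociated subset spans: the relation that prevents the addition of \<open>r\<close>
  must involve \<open>r\<close>, with coefficient 1 or -1.
\<close>
lemma exists_dissociated_spanning:
  assumes "finite R"
  obtains \<Lambda> where "\<Lambda> \<subseteq> R" "dissociated M \<Lambda>"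
    and "\<And>r. r \<in> R \<Longrightarrow> \<exists>\<epsilon>. (\<forall>\<gamma>\<in>\<Lambda>. \<epsilon> \<gamma> \<in> {-1, 0, 1}) \<and> r mod int M = (\<Sum>\<gamma>\<in>\<Lambda>. \<epsilon> \<gamma> * \<gamma>) mod int M"
proof -
  let ?C = "{\<Lambda>. \<Lambda> \<subseteq> R \<and> dissociated M \<Lambda>}"
  have "finite ?C" using assms by simp
  moreover have "{} \<in> ?C" by (simp add: dissociated_def)
  then have "?C \<noteq> {}" by blast
  ultimately have "\<exists>\<Lambda>\<in>?C. \<forall>\<Lambda>'\<in>?C. \<Lambda> \<subseteq> \<Lambda>' \<longrightarrow> \<Lambda> = \<Lambda>'" by (rule finite_has_maximal)
  then obtain \<Lambda> where \<Lambda>: "\<Lambda> \<in> ?C" and max': "\<forall>\<Lambda>'\<in>?C. \<Lambda> \<subseteq> \<Lambda>' \<longrightarrow> \<Lambda> = \<Lambda>'" by (rule bexE)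
  have max: "\<Lambda> = \<Lambda>'" if "\<Lambda>' \<in> ?C" "\<Lambda> \<subseteq> \<Lambda>'" for \<Lambda>'
    using max' that by metis
  have fin: "finite \<Lambda>" using \<Lambda> assms by (auto intro: finite_subset)
  show ?thesis
  proof (rule that[of \<Lambda>])
    fix r assume r: "r \<in> R"
    show "\<exists>\<epsilon>. (\<forall>\<gamma>\<in>\<Lambda>. \<epsilon> \<gamma> \<in> {-1, 0, 1}) \<and> r mod int M = (\<Sum>\<gamma>\<in>\<Lambda>. \<epsilon> \<gamma> * \<gamma>) mod int M"
    proof (cases "r \<in> \<Lambda>")
      case True
      have "(\<Sum>\<gamma>\<in>\<Lambda>. (if \<gamma> = r then 1 else 0) * \<gamma>) = (\<Sum>\<gamma>\<in>\<Lambda>. if \<gamma> = r then r else 0)"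
        by (intro sum.cong) auto
      also have "\<dots> = r" using True fin by simp
      finally show ?thesis by (intro exI[of _ "\<lambda>\<gamma>. if \<gamma> = r then 1 else 0"]) auto
    next
      case False
      then have "\<not> dissociated M (insert r \<Lambda>)" using max[of "insert r \<Lambda>"] \<Lambda> r by auto
      then obtain \<epsilon> where \<epsilon>: "\<forall>\<gamma>\<in>insert r \<Lambda>. \<epsilon> \<gamma> \<in> {-1, 0, 1}"
        and dvd: "int M dvd (\<Sum>\<gamma>\<in>insert r \<Lambda>. \<epsilon> \<gamma> * \<gamma>)" and nz: "\<exists>\<gamma>\<in>insert r \<Lambda>. \<epsilon> \<gamma> \<noteq> 0"
        unfolding dissociated_def by blast
      have dvd': "int M dvd \<epsilon> r * r + (\<Sum>\<gamma>\<in>\<Lambda>. \<epsilon> \<gamma> * \<gamma>)" using dvd False fin by simp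
      have "\<epsilon> r \<noteq> 0"
      proof
        assume "\<epsilon> r = 0"
        then show False using dvd' nz \<epsilon> \<Lambda> unfolding dissociated_def by auto
      qed
      then consider "\<epsilon> r = 1" | "\<epsilon> r = -1" using \<epsilon> by auto
      then show ?thesis
      proof cases
        case 1
        then have "r mod int M = (\<Sum>\<gamma>\<in>\<Lambda>. - \<epsilon> \<gamma> * \<gamma>) mod int M"
          using dvd' by (simp add: mod_eq_dvd_iff sum_negf)
        then show ?thesis using \<epsilon> by (intro exI[of _ "\<lambda>\<gamma>. - \<epsilon> \<gamma>"]) auto
      next
        case 2
        then have "int M dvd - (r - (\<Sum>\<gamma>\<in>\<Lambda>. \<epsilon> \<gamma> * \<gamma>))" using dvd' by simp
        then have "r mod int M = (\<Sum>\<gamma>\<in>\<Lambda>. \<epsilon> \<gamma> * \<gamma>) mod int M"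
          unfolding dvd_minus_iff by (simp add: mod_eq_dvd_iff)
        then show ?thesis using \<epsilon> by (intro exI[of _ \<epsilon>]) auto
      qed
    qed
  qed (use \<Lambda> in auto)
qed

section \<open>Fourier expansion and sampling of characters\<close>

text \<open>
  The Fourier coefficients of the sumset density.
\<close>
definition density_coeff :: "nat \<Rightarrow> int set \<Rightarrow> int set \<Rightarrow> int \<Rightarrow> complex" where
  "density_coeff M A B r =
     (\<Sum>a\<in>A. echar M (- (r * a))) * (\<Sum>b\<in>B. echar M (- (r * b))) / of_nat (M * card B)"

lemma sumset_density_fourier:
  assumes M: "M > 0" and A: "A \<subseteq> {0..<int M}"
  shows "complex_of_real (sumset_density M A B x)
          = (\<Sum>r\<in>{0..<int M}. density_coeff M A B r * echar M (r * x))"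
proof -
  let ?Z = "{0..<int M}"
  have finA: "finite A" using finite_subset[OF A] by simp
  have rep: "of_bool ((x - b) mod int M \<in> A) = (\<Sum>a\<in>A. if int M dvd x - a - b then 1 else (0 :: complex))" for b
  proof -
    have "int M dvd x - a - b \<longleftrightarrow> a = (x - b) mod int M" if "a \<in> A" for a
    proof -
      have "int M dvd x - a - b \<longleftrightarrow> (x - b) mod int M = a mod int M"
        by (simp add: mod_eq_dvd_iff algebra_simps)
      then show ?thesis using that A by auto
    qed
    then have "(\<Sum>a\<in>A. if int M dvd x - a - b then 1 else (0 :: complex))
        = (\<Sum>a\<in>A. if a = (x - b) mod int M then 1 else 0)"
      by (intro sum.cong) auto
    then show ?thesis using finA by simp
  qed
  have "density_coeff M A B r * echar M (r * x)
      = (\<Sum>a\<in>A. \<Sum>b\<in>B. echar M ((x - a - b) * r)) / of_nat (M * card B)" for r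
  proof -
    have "echar M ((x - a - b) * r) = echar M (- (r * a)) * echar M (- (r * b)) * echar M (r * x)" for a b
      by (simp add: algebra_simps flip: echar_add)
    then show ?thesis
      unfolding density_coeff_def sum_product by (simp only: sum_distrib_right times_divide_eq_left)
  qed
  then have "(\<Sum>r\<in>?Z. density_coeff M A B r * echar M (r * x))
      = (\<Sum>r\<in>?Z. \<Sum>a\<in>A. \<Sum>b\<in>B. echar M ((x - a - b) * r)) / of_nat (M * card B)"
    by (simp flip: sum_divide_distrib)
  also have "(\<Sum>r\<in>?Z. \<Sum>a\<in>A. \<Sum>b\<in>B. echar M ((x - a - b) * r))
      = (\<Sum>b\<in>B. \<Sum>a\<in>A. \<Sum>r\<in>?Z. echar M ((x - a - b) * r))"
    by (subst sum.swap, subst sum.swap[of _ ?Z], subst sum.swap[of _ B]) (intro sum.cong refl sum.swap)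
  also have "\<dots> = (\<Sum>b\<in>B. \<Sum>a\<in>A. of_nat M * (if int M dvd x - a - b then 1 else 0))"
    by (intro sum.cong refl) (simp add: echar_orthogonality[OF M])
  also have "\<dots> = of_nat M * (\<Sum>b\<in>B. of_bool ((x - b) mod int M \<in> A))"
    unfolding rep by (simp add: sum_distrib_left)
  finally have "(\<Sum>r\<in>?Z. density_coeff M A B r * echar M (r * x))
      = of_nat M * (\<Sum>b\<in>B. of_bool ((x - b) mod int M \<in> A)) / of_nat (M * card B)" .
  moreover have "complex_of_real (of_bool P) = of_bool P" for P by (cases P) auto
  ultimately show ?thesis using M by (simp add: sumset_density_def)
qed

lemma parseval_indicator:
  assumes M: "M > 0" and A: "A \<subseteq> {0..<int M}"
  shows "(\<Sum>r\<in>{0..<int M}. (norm (\<Sum>a\<in>A. echar M (- (r * a))))\<^sup>2) = real M * real (card A)"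
proof -
  let ?Z = "{0..<int M}"
  have finA: "finite A" using finite_subset[OF A] by simp
  have "complex_of_real (\<Sum>r\<in>?Z. (norm (\<Sum>a\<in>A. echar M (- (r * a))))\<^sup>2)
      = (\<Sum>r\<in>?Z. \<Sum>a\<in>A. \<Sum>a'\<in>A. echar M ((a' - a) * r))"
    unfolding of_real_sum complex_norm_square cnj_sum sum_product
    by (intro sum.cong refl) (simp add: echar_minus[symmetric] algebra_simps flip: echar_add)
  also have "\<dots> = (\<Sum>a\<in>A. \<Sum>a'\<in>A. \<Sum>r\<in>?Z. echar M ((a' - a) * r))"
    by (subst sum.swap) (intro sum.cong refl sum.swap)
  also have "\<dots> = (\<Sum>a\<in>A. \<Sum>a'\<in>A. if a' = a then of_nat M else 0)"
  proof (intro sum.cong refl)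
    fix a a' assume "a \<in> A" "a' \<in> A"
    then have "a' mod int M = a'" "a mod int M = a" using A by auto
    then have "int M dvd a' - a \<longleftrightarrow> a' = a"
      using mod_eq_dvd_iff[of a' "int M" a] by simp
    then show "(\<Sum>r\<in>?Z. echar M ((a' - a) * r)) = (if a' = a then of_nat M else 0)"
      by (simp add: echar_orthogonality[OF M])
  qed
  also have "\<dots> = complex_of_real (real M * real (card A))"
    using finA by simp
  finally show ?thesis by (simp only: of_real_eq_iff)
qed

text \<open>
  The Cauchy-Schwarz inequality and the identity of Parseval for \<open>A\<close> and for
  \<open>B\<close>.
\<close>
lemma sum_norm_density_coeff:
  assumes M: "M > 0" and A: "A \<subseteq> {0..<int M}" and B: "B \<subseteq> {0..<int M}" "B \<noteq> {}"
  shows "(\<Sum>r\<in>{0..<int M}. norm (density_coeff M A B r)) \<le> sqrt (real (card A) / real (card B))"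
proof -
  let ?Z = "{0..<int M}"
  define \<alpha> where "\<alpha> r = norm (\<Sum>a\<in>A. echar M (- (r * a)))" for r
  define \<beta> where "\<beta> r = norm (\<Sum>b\<in>B. echar M (- (r * b)))" for r
  have n: "0 < real (card B)" using finite_subset[OF B(1)] B by (simp add: card_gt_0_iff)
  have "(\<Sum>r\<in>?Z. norm (density_coeff M A B r)) = (\<Sum>r\<in>?Z. \<bar>\<alpha> r\<bar> * \<bar>\<beta> r\<bar>) / (real M * real (card B))"
    unfolding sum_divide_distrib
    by (intro sum.cong refl) (simp add: density_coeff_def \<alpha>_def \<beta>_def norm_mult norm_divide)
  also have "\<dots> \<le> (L2_set \<alpha> ?Z * L2_set \<beta> ?Z) / (real M * real (card B))"
    by (intro divide_right_mono L2_set_mult_ineq) auto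
  also have "L2_set \<alpha> ?Z = sqrt (real M * real (card A))"
    unfolding L2_set_def \<alpha>_def parseval_indicator[OF M A] ..
  also have "L2_set \<beta> ?Z = sqrt (real M * real (card B))"
    unfolding L2_set_def \<beta>_def parseval_indicator[OF M B(1)] ..
  also have "sqrt (real M * real (card A)) * sqrt (real M * real (card B)) / (real M * real (card B))
      = sqrt (real (card A) / real (card B))"
    using M n by (simp add: real_sqrt_mult real_sqrt_divide field_simps)
  finally show ?thesis .
qed

text \<open>
  Averaging over differences of \<open>T\<close> is convolution with the uniform measure on
  \<open>T\<close> and with its reflection, and their transforms are complex conjugates.
\<close>
lemma difference_average_fourier:
  assumes f: "\<And>x. complex_of_real (f x) = (\<Sum>r\<in>R. c r * echar M (r * x))"
  shows "complex_of_real (difference_average T f x)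
          = (\<Sum>r\<in>R. c r * of_real ((norm (set_transform M T r))\<^sup>2) * echar M (r * x))"
proof -
  let ?t = "of_nat (card T) :: complex"
  have "complex_of_real (difference_average T f x)
      = (\<Sum>p\<in>T \<times> T. \<Sum>r\<in>R. c r * echar M (r * (x + fst p - snd p))) / (?t * ?t)"
    by (simp add: difference_average_def f card_cartesian_product)
  also have "\<dots> = (\<Sum>r\<in>R. (\<Sum>p\<in>T \<times> T. c r * echar M (r * (x + fst p - snd p))) / (?t * ?t))"
    by (subst sum.swap) (simp add: sum_divide_distrib)
  also have "\<dots> = (\<Sum>r\<in>R. c r * of_real ((norm (set_transform M T r))\<^sup>2) * echar M (r * x))"
  proof (intro sum.cong refl)
    fix r
    have "(\<Sum>p\<in>T \<times> T. c r * echar M (r * (x + fst p - snd p)))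
        = (\<Sum>u\<in>T. \<Sum>v\<in>T. c r * echar M (r * x) * (echar M (r * u) * cnj (echar M (r * v))))"
      unfolding sum.cartesian_product
      by (intro sum.cong refl) (auto simp: echar_add echar_diff distrib_left right_diff_distrib)
    also have "\<dots> = c r * echar M (r * x) * ((\<Sum>u\<in>T. echar M (r * u)) * cnj (\<Sum>v\<in>T. echar M (r * v)))"
      unfolding cnj_sum sum_product by (simp add: sum_distrib_left)
    finally show "(\<Sum>p\<in>T \<times> T. c r * echar M (r * (x + fst p - snd p))) / (?t * ?t)
        = c r * of_real ((norm (set_transform M T r))\<^sup>2) * echar M (r * x)"
      unfolding complex_norm_square by (simp add: set_transform_def)
  qed
  finally show ?thesis .
qed

lemma difference_average_iterate_fourier:
  assumes f: "\<And>x. complex_of_real (f x) = (\<Sum>r\<in>R. c r * echar M (r * x))"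
  shows "complex_of_real ((difference_average T ^^ l) f x)
          = (\<Sum>r\<in>R. c r * of_real (norm (set_transform M T r) ^ (2 * l)) * echar M (r * x))"
proof (induction l arbitrary: x)
  case (Suc l)
  have "complex_of_real ((difference_average T ^^ Suc l) f x)
      = complex_of_real (difference_average T ((difference_average T ^^ l) f) x)" by simp
  also have "\<dots> = (\<Sum>r\<in>R. c r * of_real (norm (set_transform M T r) ^ (2 * l))
      * of_real ((norm (set_transform M T r))\<^sup>2) * echar M (r * x))"
    by (rule difference_average_fourier[OF Suc.IH])
  finally show ?case by (simp add: power_add power2_eq_square mult_ac)
qed (simp add: f)

lemma exists_le_weighted_mean:
  fixes w E :: "'a \<Rightarrow> real"
  assumes "finite P" "\<And>f. f \<in> P \<Longrightarrow> 0 \<le> w f" "sum w P = 1" "(\<Sum>f\<in>P. w f * E f) \<le> V"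
  shows "\<exists>f\<in>P. E f \<le> V"
proof -
  have P: "E ` P \<noteq> {}" "finite (E ` P)" using assms(1,3) by auto
  have "Min (E ` P) = (\<Sum>f\<in>P. w f * Min (E ` P))"
    using assms(3) by (simp flip: sum_distrib_right)
  also have "\<dots> \<le> (\<Sum>f\<in>P. w f * E f)"
    using assms(1,2) by (intro sum_mono mult_left_mono) auto
  also have "\<dots> \<le> V" by fact
  finally show ?thesis using Min_in[OF P(2,1)] by auto
qed

lemma cyclic_trig_polynomial:
  assumes "M > 0"
  shows "cyclic M (\<lambda>x. Re (\<Sum>r\<in>R. c r * echar M (r * x)))"
proof -
  have "echar M (r * (x mod int M)) = echar M (r * x)" for r x
    by (intro echar_cong[OF assms]) (simp add: mod_simps)
  then show ?thesis by (simp add: cyclic_def)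
qed

text \<open>
  The coefficients, divided by their sum in absolute value, are the weights of a random character
  (with a phase) whose expectation is the given polynomial up to that factor. A sample of \<open>k\<close>
  characters is therefore a good approximation in the power norm, and a shift \<open>t\<close> that hardly changes
  the \<open>k\<close> sampled characters hardly changes their average.
\<close>
lemma trig_polynomial_sparsification:
  fixes c :: "int \<Rightarrow> complex"
  assumes M: "M > 0" and R: "finite R" and W: "(\<Sum>r\<in>R. norm (c r)) \<le> W"
    and m: "0 < m" and k: "0 < k" and \<rho>: "real m / real k \<le> \<rho>"
  obtains g :: "int \<Rightarrow> real" and \<Gamma> where "finite \<Gamma>" "card \<Gamma> \<le> k" "cyclic M g"
    and "(\<Sum>x\<in>{0..<int M}. (Re (\<Sum>r\<in>R. c r * echar M (r * x)) - g x) ^ (2 * m))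
          \<le> W ^ (2 * m) * (real M * (2 * (12 * \<rho>) ^ m + 2 * (48 * \<rho>\<^sup>2) ^ m))"
    and "\<And>x t \<eta>. 0 \<le> \<eta> \<Longrightarrow> \<forall>r\<in>\<Gamma>. norm (echar M (r * t) - 1) \<le> \<eta> \<Longrightarrow> \<bar>g (x + t) - g x\<bar> \<le> W * \<eta>"
proof -
  define w0 where "w0 = (\<Sum>r\<in>R. norm (c r))"
  define V where "V = real M * (2 * (12 * \<rho>) ^ m + 2 * (48 * \<rho>\<^sup>2) ^ m)"
  have w0W: "0 \<le> w0" "w0 \<le> W" using W by (auto simp: w0_def sum_nonneg)
  have \<rho>0: "0 \<le> \<rho>" using \<rho> by (rule order.trans[rotated]) auto
  then have V0: "0 \<le> V" by (simp add: V_def)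
  show ?thesis
  proof (cases "w0 = 0")
    case True
    then have "c r = 0" if "r \<in> R" for r
      using that R by (simp add: w0_def sum_nonneg_eq_0_iff)
    then have zero: "Re (\<Sum>r\<in>R. c r * echar M (r * x)) = 0" for x by simp
    have "0 \<le> W ^ (2 * m) * V" using V0 w0W by simp
    then show ?thesis using m w0W
      by (intro that[of "{}" "\<lambda>_. 0"]) (simp_all only: zero V_def[symmetric], simp_all add: zero_power cyclic_def)
  next
    case False
    then have w0: "0 < w0" using w0W by simp
    define w where "w r = norm (c r) / w0" for r
    define \<phi> where "\<phi> x r = Re (sgn (c r) * echar M (r * x))" for x r
    define \<mu> where "\<mu> x = (\<Sum>r\<in>R. w r * \<phi> x r)" for x
    let ?P = "PiE {..<k} (\<lambda>_. R)"
    have w_nonneg: "0 \<le> w r" for r using w0 by (simp add: w_def)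
    have w_sum: "sum w R = 1" using w0 by (simp add: w_def w0_def flip: sum_divide_distrib)
    have \<phi>1: "\<bar>\<phi> x r\<bar> \<le> 1" for x r
    proof -
      have "\<bar>\<phi> x r\<bar> \<le> norm (sgn (c r) * echar M (r * x))" unfolding \<phi>_def by (rule abs_Re_le_cmod)
      also have "\<dots> \<le> 1" by (simp add: norm_mult norm_sgn)
      finally show ?thesis .
    qed
    have \<mu>: "Re (\<Sum>r\<in>R. c r * echar M (r * x)) = w0 * \<mu> x" for x
    proof -
      have "c r = of_real (norm (c r)) * sgn (c r)" for r by (simp add: sgn_eq)
      then have "c r * echar M (r * x) = of_real (norm (c r)) * (sgn (c r) * echar M (r * x))" for r
        by (metis mult.assoc)
      then have "Re (\<Sum>r\<in>R. c r * echar M (r * x)) = (\<Sum>r\<in>R. norm (c r) * \<phi> x r)"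
        by (simp only: Re_sum \<phi>_def) simp
      then show ?thesis using w0 by (simp add: \<mu>_def w_def sum_distrib_left)
    qed
    have moment: "(\<Sum>f\<in>?P. (\<Prod>i<k. w (f i)) * ((\<Sum>i<k. \<phi> x (f i)) / real k - \<mu> x) ^ (2 * m))
        \<le> 2 * (12 * \<rho> * 1) ^ m + 2 * (48 * \<rho>\<^sup>2) ^ m" for x
    proof (rule sample_mean_moment[OF R w_nonneg w_sum \<phi>1 \<mu>_def _ m k \<rho>])
      have "(\<phi> x r)\<^sup>2 \<le> 1" for r using \<phi>1[of x r] by (simp add: abs_square_le_1)
      then have "(\<Sum>r\<in>R. w r * (\<phi> x r)\<^sup>2) \<le> (\<Sum>r\<in>R. w r * 1)"
        using w_nonneg by (intro sum_mono mult_left_mono)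
      then show "(\<Sum>r\<in>R. w r * (\<phi> x r)\<^sup>2) \<le> 1" using w_sum by simp
    qed
    have "\<exists>f\<in>?P. (\<Sum>x\<in>{0..<int M}. ((\<Sum>i<k. \<phi> x (f i)) / real k - \<mu> x) ^ (2 * m)) \<le> V"
    proof (rule exists_le_weighted_mean)
      show "finite ?P" using R by (intro finite_PiE) auto
      show "(\<Sum>f\<in>?P. \<Prod>i<k. w (f i)) = 1" by (rule sum_tuple_weights[OF R w_sum])
      show "0 \<le> (\<Prod>i<k. w (f i))" for f by (intro prod_nonneg) (auto simp: w_nonneg)
      have "(\<Sum>f\<in>?P. (\<Prod>i<k. w (f i)) * (\<Sum>x\<in>{0..<int M}. ((\<Sum>i<k. \<phi> x (f i)) / real k - \<mu> x) ^ (2 * m)))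
          = (\<Sum>x\<in>{0..<int M}. \<Sum>f\<in>?P. (\<Prod>i<k. w (f i)) * ((\<Sum>i<k. \<phi> x (f i)) / real k - \<mu> x) ^ (2 * m))"
        by (subst sum.swap) (simp add: sum_distrib_left)
      also have "\<dots> \<le> (\<Sum>x\<in>{0..<int M}. 2 * (12 * \<rho> * 1) ^ m + 2 * (48 * \<rho>\<^sup>2) ^ m)"
        by (intro sum_mono moment)
      also have "\<dots> = V" by (simp add: V_def)
      finally show "(\<Sum>f\<in>?P. (\<Prod>i<k. w (f i)) * (\<Sum>x\<in>{0..<int M}. ((\<Sum>i<k. \<phi> x (f i)) / real k - \<mu> x) ^ (2 * m))) \<le> V" .
    qed
    then obtain f where f: "(\<Sum>x\<in>{0..<int M}. ((\<Sum>i<k. \<phi> x (f i)) / real k - \<mu> x) ^ (2 * m)) \<le> V"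
      by blast
    define g where "g x = w0 * ((\<Sum>i<k. \<phi> x (f i)) / real k)" for x
    show ?thesis
    proof (rule that[of "f ` {..<k}" g])
      show "card (f ` {..<k}) \<le> k" using card_image_le[of "{..<k}" f] by simp
      have "\<phi> (x mod int M) r = \<phi> x r" for x r
        using cyclic_trig_polynomial[OF M, where R = "{r}" and c = "\<lambda>r. sgn (c r)"] by (simp add: cyclic_def \<phi>_def)
      then show "cyclic M g" by (simp add: cyclic_def g_def)
      have "(w0 * \<mu> x - g x) ^ (2 * m) = w0 ^ (2 * m) * ((\<Sum>i<k. \<phi> x (f i)) / real k - \<mu> x) ^ (2 * m)" for x
      proof -
        have "(w0 * \<mu> x - g x) ^ (2 * m) = (g x - w0 * \<mu> x) ^ (2 * m)"
          by (simp add: power_mult power2_commute)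
        also have "g x - w0 * \<mu> x = w0 * ((\<Sum>i<k. \<phi> x (f i)) / real k - \<mu> x)"
          by (simp add: g_def right_diff_distrib)
        finally show ?thesis by (simp only: power_mult_distrib)
      qed
      then have "(\<Sum>x\<in>{0..<int M}. (Re (\<Sum>r\<in>R. c r * echar M (r * x)) - g x) ^ (2 * m))
          = w0 ^ (2 * m) * (\<Sum>x\<in>{0..<int M}. ((\<Sum>i<k. \<phi> x (f i)) / real k - \<mu> x) ^ (2 * m))"
        by (simp only: \<mu> sum_distrib_left)
      also have "\<dots> \<le> W ^ (2 * m) * V"
        using w0W V0 by (intro mult_mono power_mono f) (auto intro!: sum_nonneg)
      finally show "(\<Sum>x\<in>{0..<int M}. (Re (\<Sum>r\<in>R. c r * echar M (r * x)) - g x) ^ (2 * m))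
          \<le> W ^ (2 * m) * (real M * (2 * (12 * \<rho>) ^ m + 2 * (48 * \<rho>\<^sup>2) ^ m))"
        by (simp only: V_def)
      fix x t \<eta> assume \<eta>: "0 \<le> (\<eta> :: real)" "\<forall>r\<in>f ` {..<k}. norm (echar M (r * t) - 1) \<le> \<eta>"
      have one: "\<bar>\<phi> (x + t) (f i) - \<phi> x (f i)\<bar> \<le> \<eta>" if "i < k" for i
      proof -
        have "\<phi> (x + t) (f i) - \<phi> x (f i)
            = Re (sgn (c (f i)) * echar M (f i * x) * (echar M (f i * t) - 1))"
          unfolding \<phi>_def distrib_left echar_add by (simp add: algebra_simps)
        also have "\<bar>\<dots>\<bar> \<le> norm (sgn (c (f i)) * echar M (f i * x) * (echar M (f i * t) - 1))"
          by (rule abs_Re_le_cmod)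
        also have "\<dots> \<le> 1 * norm (echar M (f i * t) - 1)"
          by (simp add: norm_mult norm_sgn)
        also have "\<dots> \<le> \<eta>" using \<eta>(2) that by simp
        finally show ?thesis .
      qed
      have "\<bar>g (x + t) - g x\<bar> = w0 * (\<bar>\<Sum>i<k. \<phi> (x + t) (f i) - \<phi> x (f i)\<bar> / real k)"
        using w0 k unfolding g_def sum_subtractf
        by (simp add: abs_mult flip: right_diff_distrib diff_divide_distrib)
      also have "\<dots> \<le> w0 * ((\<Sum>i<k. \<eta>) / real k)"
        using w0 one by (intro mult_left_mono divide_right_mono order.trans[OF sum_abs] sum_mono) auto
      also have "\<dots> = w0 * \<eta>" using k by simp
      also have "\<dots> \<le> W * \<eta>" using w0W \<eta>(1) by (intro mult_right_mono)
      finally show "\<bar>g (x + t) - g x\<bar> \<le> W * \<eta>" .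
    qed simp
  qed
qed

section \<open>A Bohr set of almost periods\<close>

lemma norm_echar_combination_le:
  assumes M: "M > 0" and \<epsilon>: "\<And>\<gamma>. \<gamma> \<in> \<Lambda> \<Longrightarrow> \<epsilon> \<gamma> \<in> {-1, 0, 1}"
    and r: "r mod int M = (\<Sum>\<gamma>\<in>\<Lambda>. \<epsilon> \<gamma> * \<gamma>) mod int M"
  shows "norm (echar M (r * y) - 1) \<le> (\<Sum>\<gamma>\<in>\<Lambda>. norm (echar M (\<gamma> * y) - 1))"
proof -
  have "(r * y) mod int M = ((\<Sum>\<gamma>\<in>\<Lambda>. \<epsilon> \<gamma> * \<gamma>) * y) mod int M"
    using r by (metis mod_mult_left_eq)
  then have "echar M (r * y) = echar M ((\<Sum>\<gamma>\<in>\<Lambda>. \<epsilon> \<gamma> * \<gamma>) * y)"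
    by (rule echar_cong[OF M])
  also have "\<dots> = (\<Prod>\<gamma>\<in>\<Lambda>. echar M (\<epsilon> \<gamma> * \<gamma> * y))"
    by (simp add: sum_distrib_right echar_sum)
  finally have "norm (echar M (r * y) - 1)
      = norm ((\<Prod>\<gamma>\<in>\<Lambda>. echar M (\<epsilon> \<gamma> * \<gamma> * y)) - (\<Prod>\<gamma>\<in>\<Lambda>. 1))" by simp
  also have "\<dots> \<le> (\<Sum>\<gamma>\<in>\<Lambda>. norm (echar M (\<epsilon> \<gamma> * \<gamma> * y) - 1))"
    by (rule norm_prod_diff) auto
  also have "\<dots> \<le> (\<Sum>\<gamma>\<in>\<Lambda>. norm (echar M (\<gamma> * y) - 1))"
  proof (rule sum_mono)
    fix \<gamma> assume "\<gamma> \<in> \<Lambda>"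
    then consider "\<epsilon> \<gamma> = -1" | "\<epsilon> \<gamma> = 0" | "\<epsilon> \<gamma> = 1" using \<epsilon> by auto
    then show "norm (echar M (\<epsilon> \<gamma> * \<gamma> * y) - 1) \<le> norm (echar M (\<gamma> * y) - 1)"
    proof cases
      case 1
      have "norm (cnj (echar M (\<gamma> * y) - 1)) = norm (echar M (\<gamma> * y) - 1)" by (rule complex_mod_cnj)
      then show ?thesis using 1 by (simp add: echar_minus)
    qed auto
  qed
  finally show ?thesis .
qed

lemma trig_polynomial_shift_le:
  assumes "\<And>r. r \<in> R \<Longrightarrow> norm (echar M (r * y) - 1) \<le> \<eta>" "0 \<le> \<eta>"
    and "(\<Sum>r\<in>R. norm (c r)) \<le> W"
  shows "\<bar>Re (\<Sum>r\<in>R. c r * echar M (r * (x + y))) - Re (\<Sum>r\<in>R. c r * echar M (r * x))\<bar> \<le> W * \<eta>"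
proof -
  have "Re (\<Sum>r\<in>R. c r * echar M (r * (x + y))) - Re (\<Sum>r\<in>R. c r * echar M (r * x))
      = Re (\<Sum>r\<in>R. c r * echar M (r * x) * (echar M (r * y) - 1))"
    unfolding minus_complex.sel(1)[symmetric] sum_subtractf[symmetric] distrib_left echar_add
    by (simp add: algebra_simps)
  also have "\<bar>\<dots>\<bar> \<le> norm (\<Sum>r\<in>R. c r * echar M (r * x) * (echar M (r * y) - 1))"
    by (rule abs_Re_le_cmod)
  also have "\<dots> \<le> (\<Sum>r\<in>R. norm (c r) * \<eta>)"
    using assms(1) by (intro sum_norm_le) (simp add: norm_mult mult_left_mono)
  also have "\<dots> \<le> W * \<eta>"
    using assms(2,3) by (simp add: mult_right_mono flip: sum_distrib_right)
  finally show ?thesis .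
qed

text \<open>
  The constant 55296 is \<open>4 \<cdot> 12 \<cdot> 8 \<cdot> 144\<close>. The factor \<open>1/144 = (1/12)\<^sup>2\<close> corresponds to an error of \<open>1/12\<close> in
  the power norm, so that six such errors add up to \<open>1/2\<close>; the factor 8 absorbs the numerical
  factors in front of the powers.
\<close>
lemma sampling_constant:
  fixes l :: real
  assumes "1 \<le> l" "0 < m"
  shows "4 ^ m * 2 * (2 * (12 / (55296 * l\<^sup>2)) ^ m + 2 * (48 / (55296 * l\<^sup>2)\<^sup>2) ^ m) * l ^ (2 * m) \<le> (1 / 144) ^ m"
proof -
  have l2: "1 \<le> l\<^sup>2" using assms(1) by simp
  have "48 / (55296 * l\<^sup>2)\<^sup>2 = (48 / (55296 * l\<^sup>2)) / (55296 * l\<^sup>2)"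
    by (simp add: power2_eq_square)
  also have "\<dots> \<le> (48 / (55296 * l\<^sup>2)) / 4" using l2 by (intro divide_left_mono) auto
  finally have "48 / (55296 * l\<^sup>2)\<^sup>2 \<le> 12 / (55296 * l\<^sup>2)" by simp
  then have "(48 / (55296 * l\<^sup>2)\<^sup>2) ^ m \<le> (12 / (55296 * l\<^sup>2)) ^ m" by (intro power_mono) auto
  then have "4 ^ m * 2 * (2 * (12 / (55296 * l\<^sup>2)) ^ m + 2 * (48 / (55296 * l\<^sup>2)\<^sup>2) ^ m) * l ^ (2 * m)
      \<le> 4 ^ m * 2 * (2 * (12 / (55296 * l\<^sup>2)) ^ m + 2 * (12 / (55296 * l\<^sup>2)) ^ m) * l ^ (2 * m)"
    using assms by (intro mult_right_mono mult_left_mono add_left_mono) auto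
  also have "\<dots> = 8 * (4 * (12 / (55296 * l\<^sup>2)) * l\<^sup>2) ^ m"
    by (simp only: power_mult_distrib power_mult) simp
  also have "4 * (12 / (55296 * l\<^sup>2)) * l\<^sup>2 = 1 / 8 * (1 / 144)" using l2 by auto
  also have "8 * (1 / 8 * (1 / 144)) ^ m = 8 * (1 / 8) ^ m * (1 / 144 :: real) ^ m"
    by (simp only: power_mult_distrib mult.assoc)
  also have "\<dots> \<le> 1 * (1 / 144) ^ m"
  proof (intro mult_right_mono)
    have "(1 / 8 :: real) ^ m \<le> (1 / 8) ^ 1" using assms(2) by (intro power_decreasing) auto
    then show "8 * (1 / 8 :: real) ^ m \<le> 1" by simp
  qed auto
  finally show ?thesis by simp
qed

text \<open>
  The two families of frequencies are \<open>\<Gamma>'\<close>, the sampled characters that replace the part of \<open>H\<close> with small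
  \<open>|\<tau>|\<close>, and \<open>\<Lambda>\<close>, the dissociated set that spans the rest. For a shift \<open>y\<close> close to 0 on \<open>\<Gamma>' \<union> \<Lambda>\<close>, the
  difference \<open>F(x + y) - F(x)\<close> is a sum of six terms: the error of \<open>H\<close> and that of the sampled polynomial,
  each at \<open>x + y\<close> and at \<open>x\<close>, and the increments of the spanned part and of the sampled polynomial.
  Each term contributes at most a \<open>144\<^sup>-\<^sup>m\<close>-fraction of the power sum \<open>S\<close> of \<open>F\<close>, hence their sum at most
  a \<open>4\<^sup>-\<^sup>m\<close>-fraction. If for every \<open>x\<close> some \<open>F(x + j t)\<close> were 0, the sum over \<open>j < L\<close> would
  dominate \<open>S\<close>, which contradicts \<open>L < 4\<^sup>m\<close>.
\<close>
lemma positive_progression: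
  fixes M k m l :: nat and A B :: "int set"
  defines "\<alpha> \<equiv> real (card A) / real M" and "\<beta> \<equiv> real (card B) / real M"
  assumes M: "M > 0" and A: "A \<subseteq> {0..<int M}" "A \<noteq> {}" and B: "B \<subseteq> {0..<int M}" "B \<noteq> {}"
    and m: "0 < m" and k: "0 < k" and l: "0 < l" and l\<beta>: "1 / \<beta> \<le> 4 ^ l"
    and mk: "real m / real k \<le> \<alpha> / (55296 * (real l)\<^sup>2)"
  obtains \<Gamma> where "finite \<Gamma>" "real (card \<Gamma>) \<le> real k + 16 * ln (2 * (1 / \<beta>) ^ k)"
    and "\<And>L t. L < 4 ^ m \<Longrightarrow>
      (\<And>\<gamma> j. \<gamma> \<in> \<Gamma> \<Longrightarrow> j < L \<Longrightarrow> norm (echar M (\<gamma> * (int j * t)) - 1) * real (card \<Gamma>) \<le> sqrt (\<alpha> * \<beta>) / 12) \<Longrightarrow>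
      \<exists>x. \<forall>j<L. 0 < sumset_density M A B (x + int j * t)"
proof -
  define F where "F = sumset_density M A B"
  define K where "K = 55296 * (real l)\<^sup>2"
  let ?Z = "{0..<int M}"
  define S where "S = (\<Sum>x\<in>?Z. F x ^ (2 * m))"
  define V where "V = (1 / 144) ^ m * S"
  have fin: "finite A" "finite B" using finite_subset[OF A(1)] finite_subset[OF B(1)] by auto
  have cA: "card A \<le> M" "card B \<le> M"
    using card_mono[OF _ A(1)] card_mono[OF _ B(1)] by auto
  have \<alpha>: "0 < \<alpha>" "\<alpha> \<le> 1" using A fin M cA by (auto simp: \<alpha>_def card_gt_0_iff)
  have \<beta>: "0 < \<beta>" "\<beta> \<le> 1" using B fin M cA by (auto simp: \<beta>_def card_gt_0_iff)
  have l1: "1 \<le> real l" using l by simp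
  have K: "0 < K" using l by (simp add: K_def)
  have S: "real M * \<alpha> ^ (2 * m) \<le> S"
    unfolding \<alpha>_def S_def F_def using A B fin M by (intro sumset_density_power_sum_ge)
  have S0: "0 < S" by (rule less_le_trans[OF _ S]) (use M \<alpha> in simp)
  have V0: "0 \<le> V" using S0 by (simp add: V_def)
  have cF: "cyclic M F" by (simp add: F_def cyclic_sumset_density)

  have mk': "real m / real k \<le> (real (card A) / real M) / K" using mk by (simp add: \<alpha>_def K_def)
  obtain T where T: "T \<subseteq> ?Z" "M * card B ^ k \<le> 2 * (M ^ k * card T)"
    and period: "\<And>u v. u \<in> T \<Longrightarrow> v \<in> T \<Longrightarrow> (\<Sum>x\<in>?Z. (F (x + u - v) - F x) ^ (2 * m))
        \<le> 4 ^ m * 2 * (2 * (12 / K) ^ m + 2 * (48 / K\<^sup>2) ^ m) * S"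
    by (rule almost_periods[OF M A B m k K mk', folded F_def, folded S_def]) (rule that)
  have finT: "finite T" using finite_subset[OF T(1)] by simp
  have T0: "T \<noteq> {}"
  proof
    assume "T = {}"
    then have "M * card B ^ k = 0" using T(2) by simp
    then show False using M B fin by simp
  qed
  have T_large: "real M / real (card T) \<le> 2 * (1 / \<beta>) ^ k"
  proof -
    have t: "0 < real (card T)" using finT T0 by (simp add: card_gt_0_iff)
    have b: "0 < real (card B)" using fin B by (simp add: card_gt_0_iff)
    have "real M * real (card B) ^ k \<le> 2 * (real M ^ k * real (card T))"
      using T(2) by (simp flip: of_nat_power of_nat_mult add: of_nat_mult[symmetric] del: of_nat_mult of_nat_power)
    then have "real M / real (card T) \<le> 2 * (real M ^ k / real (card B) ^ k)"
      using t b by (simp add: field_simps)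
    then show ?thesis by (simp add: \<beta>_def power_divide)
  qed

  define H where "H = (difference_average T ^^ l) F"
  have cH: "cyclic M H" unfolding H_def by (rule cyclic_difference_average_iterate[OF cF])
  have HF: "(\<Sum>x\<in>?Z. (H x - F x) ^ (2 * m)) \<le> V"
  proof -
    have "(\<Sum>x\<in>?Z. (H x - F x) ^ (2 * m))
        \<le> real l ^ (2 * m) * (4 ^ m * 2 * (2 * (12 / K) ^ m + 2 * (48 / K\<^sup>2) ^ m) * S)"
      unfolding H_def by (rule difference_average_iterate_close[OF M cF finT T0 m period])
    also have "\<dots> = (4 ^ m * 2 * (2 * (12 / K) ^ m + 2 * (48 / K\<^sup>2) ^ m) * real l ^ (2 * m)) * S"
      by (simp only: mult_ac)
    also have "\<dots> \<le> (1 / 144) ^ m * S"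
      unfolding K_def using S0 by (intro mult_right_mono sampling_constant[OF l1 m]) auto
    finally show ?thesis by (simp only: V_def)
  qed

  define c where "c r = density_coeff M A B r * of_real (norm (set_transform M T r) ^ (2 * l))" for r
  define R where "R = {r \<in> ?Z. 1 / 2 \<le> norm (set_transform M T r)}"
  define lg where "lg x = Re (\<Sum>r\<in>R. c r * echar M (r * x))" for x
  define sm where "sm x = Re (\<Sum>r\<in>?Z - R. c r * echar M (r * x))" for x
  have H_split: "H x = lg x + sm x" for x
  proof -
    have "complex_of_real (H x) = (\<Sum>r\<in>?Z. c r * echar M (r * x))"
      unfolding H_def c_def F_def
      by (rule difference_average_iterate_fourier[OF sumset_density_fourier[OF M A(1)]])
    also have "\<dots> = (\<Sum>r\<in>?Z - R. c r * echar M (r * x)) + (\<Sum>r\<in>R. c r * echar M (r * x))"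
      by (rule sum.subset_diff) (auto simp: R_def)
    finally have "Re (complex_of_real (H x)) = sm x + lg x"
      by (simp only: plus_complex.sel lg_def sm_def)
    then show ?thesis by simp
  qed
  have coeff: "(\<Sum>r\<in>?Z. norm (density_coeff M A B r)) \<le> sqrt (\<alpha> / \<beta>)"
    using sum_norm_density_coeff[OF M A(1) B] M by (simp add: \<alpha>_def \<beta>_def)
  have \<tau>1: "norm (set_transform M T r) \<le> 1" for r
  proof -
    have "norm (\<Sum>u\<in>T. echar M (r * u)) \<le> (\<Sum>u\<in>T. 1)" by (intro sum_norm_le) simp
    moreover have "0 < real (card T)" using finT T0 by (simp add: card_gt_0_iff)
    ultimately show ?thesis by (simp add: set_transform_def norm_divide pos_divide_le_eq)
  qed
  have W_large: "(\<Sum>r\<in>R. norm (c r)) \<le> sqrt (\<alpha> / \<beta>)"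
  proof -
    have "(\<Sum>r\<in>R. norm (c r)) \<le> (\<Sum>r\<in>R. norm (density_coeff M A B r))"
      using \<tau>1 by (intro sum_mono) (auto simp: c_def norm_mult norm_power intro!: mult_left_le power_le_one)
    also have "\<dots> \<le> (\<Sum>r\<in>?Z. norm (density_coeff M A B r))"
      by (intro sum_mono2) (auto simp: R_def)
    finally show ?thesis using coeff by linarith
  qed
  have W_small: "(\<Sum>r\<in>?Z - R. norm (c r)) \<le> sqrt \<alpha>"
  proof -
    have "norm (c r) \<le> norm (density_coeff M A B r) * (1 / 4 ^ l)" if "r \<in> ?Z - R" for r
    proof -
      have "norm (set_transform M T r) ^ (2 * l) \<le> (1 / 2) ^ (2 * l)"
        using that by (intro power_mono) (auto simp: R_def)
      also have "\<dots> = 1 / 4 ^ l" by (simp add: power_mult power_divide)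
      finally have "norm (density_coeff M A B r) * norm (set_transform M T r) ^ (2 * l)
          \<le> norm (density_coeff M A B r) * (1 / 4 ^ l)" by (intro mult_left_mono) auto
      then show ?thesis by (simp add: c_def norm_mult norm_power)
    qed
    then have "(\<Sum>r\<in>?Z - R. norm (c r)) \<le> (\<Sum>r\<in>?Z - R. norm (density_coeff M A B r) * (1 / 4 ^ l))"
      by (rule sum_mono)
    also have "\<dots> \<le> (\<Sum>r\<in>?Z. norm (density_coeff M A B r) * (1 / 4 ^ l))"
      by (intro sum_mono2) auto
    also have "\<dots> \<le> sqrt (\<alpha> / \<beta>) * (1 / 4 ^ l)"
      using coeff by (simp add: divide_right_mono flip: sum_divide_distrib)
    (* This is the choice of l: the damping outside R makes up for the factor 1 / sqrt beta. *)
    also have "\<dots> \<le> sqrt (\<alpha> / \<beta>) * sqrt \<beta>"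
    proof -
      have "1 / 4 ^ l \<le> \<beta>" using l\<beta> \<beta> by (simp add: field_simps)
      also have "\<beta> \<le> sqrt \<beta>" using \<beta> by (intro real_le_rsqrt) (simp add: power2_eq_square mult_left_le)
      finally show ?thesis using \<alpha> \<beta> by (intro mult_left_mono) auto
    qed
    also have "\<dots> = sqrt \<alpha>" using \<beta> by (simp flip: real_sqrt_mult)
    finally show ?thesis .
  qed

  obtain g :: "int \<Rightarrow> real" and \<Gamma>' where \<Gamma>': "finite \<Gamma>'" "card \<Gamma>' \<le> k" and cg: "cyclic M g"
    and sg: "(\<Sum>x\<in>?Z. (sm x - g x) ^ (2 * m))
          \<le> sqrt \<alpha> ^ (2 * m) * (real M * (2 * (12 * (\<alpha> / K)) ^ m + 2 * (48 * (\<alpha> / K)\<^sup>2) ^ m))"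
    and g_shift: "\<And>x t \<eta>. 0 \<le> \<eta> \<Longrightarrow> \<forall>r\<in>\<Gamma>'. norm (echar M (r * t) - 1) \<le> \<eta> \<Longrightarrow>
          \<bar>g (x + t) - g x\<bar> \<le> sqrt \<alpha> * \<eta>"
    by (rule trig_polynomial_sparsification[OF M _ W_small m k mk, folded K_def, folded sm_def]) (simp, rule that)
  have smg: "(\<Sum>x\<in>?Z. (sm x - g x) ^ (2 * m)) \<le> V"
  proof -
    let ?q = "2 * (12 / K) ^ m + 2 * (48 / K\<^sup>2) ^ m"
    have e1: "sqrt \<alpha> ^ (2 * m) = \<alpha> ^ m" using \<alpha> by (simp add: power_mult)
    have e2: "(12 * (\<alpha> / K)) ^ m = \<alpha> ^ m * (12 / K) ^ m"
      unfolding power_mult_distrib[symmetric] by (simp add: mult.commute)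
    have e3: "(48 * (\<alpha> / K)\<^sup>2) ^ m = \<alpha> ^ m * (\<alpha> ^ m * (48 / K\<^sup>2) ^ m)"
      unfolding power_mult_distrib[symmetric] by (simp add: power2_eq_square mult_ac)
    have "\<alpha> ^ m * (48 / K\<^sup>2) ^ m \<le> (48 / K\<^sup>2) ^ m" using \<alpha> by (intro mult_left_le_one_le power_le_one) auto
    then have "(48 * (\<alpha> / K)\<^sup>2) ^ m \<le> \<alpha> ^ m * (48 / K\<^sup>2) ^ m"
      unfolding e3 using \<alpha> by (intro mult_left_mono) auto
    then have "sqrt \<alpha> ^ (2 * m) * (real M * (2 * (12 * (\<alpha> / K)) ^ m + 2 * (48 * (\<alpha> / K)\<^sup>2) ^ m))
        \<le> \<alpha> ^ m * (real M * (2 * (\<alpha> ^ m * (12 / K) ^ m) + 2 * (\<alpha> ^ m * (48 / K\<^sup>2) ^ m)))"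
      unfolding e1 e2 using \<alpha> by (intro mult_left_mono add_mono) auto
    also have "\<dots> = (real M * \<alpha> ^ (2 * m)) * ?q"
      unfolding mult_2 power_add by (simp add: algebra_simps)
    also have "\<dots> \<le> S * ?q" using S K by (intro mult_right_mono) auto
    also have "?q \<le> 4 ^ m * 2 * ?q * real l ^ (2 * m)"
    proof -
      have "1 \<le> (4 :: real) ^ m * 2" using one_le_power[of "4 :: real" m] by linarith
      moreover have "1 \<le> real l ^ (2 * m)" using l1 by (rule one_le_power)
      moreover have "0 \<le> ?q" using K by simp
      ultimately have "1 * ?q * 1 \<le> (4 ^ m * 2) * ?q * real l ^ (2 * m)"
        by (intro mult_mono) auto
      then show ?thesis by simp
    qed
    also have "\<dots> \<le> (1 / 144) ^ m" unfolding K_def by (rule sampling_constant[OF l1 m])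
    finally have "sqrt \<alpha> ^ (2 * m) * (real M * (2 * (12 * (\<alpha> / K)) ^ m + 2 * (48 * (\<alpha> / K)\<^sup>2) ^ m)) \<le> V"
      using S0 by (simp add: V_def mult.commute mult_left_mono)
    then show ?thesis using sg by linarith
  qed

  have "finite R" unfolding R_def by (rule finite_subset[of _ ?Z]) auto
  from exists_dissociated_spanning[OF this, of M] obtain \<Lambda> where \<Lambda>: "\<Lambda> \<subseteq> R" "dissociated M \<Lambda>"
    and span: "\<And>r. r \<in> R \<Longrightarrow> \<exists>\<epsilon>. (\<forall>\<gamma>\<in>\<Lambda>. \<epsilon> \<gamma> \<in> {-1, 0, 1}) \<and> r mod int M = (\<Sum>\<gamma>\<in>\<Lambda>. \<epsilon> \<gamma> * \<gamma>) mod int M"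
    by blast
  have fin\<Lambda>: "finite \<Lambda>" using \<Lambda>(1) \<open>finite R\<close> by (rule finite_subset)
  have card\<Lambda>: "real (card \<Lambda>) \<le> 16 * ln (2 * (1 / \<beta>) ^ k)"
  proof -
    have "real (card \<Lambda>) \<le> 16 * ln (real M / real (card T))"
      using \<Lambda>(1) by (intro chang_dissociated[OF M T(1) T0 fin\<Lambda> \<Lambda>(2)]) (auto simp: R_def)
    also have "\<dots> \<le> 16 * ln (2 * (1 / \<beta>) ^ k)"
    proof -
      have "0 < real M / real (card T)" using M finT T0 by (simp add: card_gt_0_iff)
      then show ?thesis using T_large by (intro mult_left_mono ln_mono) auto
    qed
    finally show ?thesis .
  qed

  define \<Gamma> where "\<Gamma> = \<Gamma>' \<union> \<Lambda>"
  show ?thesis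
  proof (rule that[of \<Gamma>])
    show fin\<Gamma>: "finite \<Gamma>" using \<Gamma>' fin\<Lambda> by (simp add: \<Gamma>_def)
    have "card \<Gamma> \<le> card \<Gamma>' + card \<Lambda>" unfolding \<Gamma>_def by (rule card_Un_le)
    then show "real (card \<Gamma>) \<le> real k + 16 * ln (2 * (1 / \<beta>) ^ k)"
      using \<Gamma>'(2) card\<Lambda> by linarith
    fix L :: nat and t :: int
    assume L: "L < 4 ^ m"
      and near: "\<And>\<gamma> j. \<gamma> \<in> \<Gamma> \<Longrightarrow> j < L \<Longrightarrow>
        norm (echar M (\<gamma> * (int j * t)) - 1) * real (card \<Gamma>) \<le> sqrt (\<alpha> * \<beta>) / 12"
    have diff: "(\<Sum>x\<in>?Z. (F (x + int j * t) - F x) ^ (2 * m)) \<le> 36 ^ m * V" if j: "j < L" for j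
    proof -
      define y where "y = int j * t"
      let ?\<eta> = "sqrt (\<alpha> * \<beta>) / 12"
      have \<eta>0: "0 \<le> ?\<eta>" using \<alpha> \<beta> by simp
      have shiftinv: "(\<Sum>x\<in>?Z. f (x + y)) = (\<Sum>x\<in>?Z. f x)" if "cyclic M f" for f :: "int \<Rightarrow> real"
        by (rule sum_cyclic_shift[OF M that])
      have const: "(\<Sum>x\<in>?Z. f x ^ (2 * m)) \<le> V" if "\<And>x. \<bar>f x\<bar> \<le> \<alpha> / 12" for f :: "int \<Rightarrow> real"
      proof -
        have "f x ^ (2 * m) \<le> (\<alpha> / 12) ^ (2 * m)" for x
          using power_mono[OF that[of x], of "2 * m"] by (simp add: power_even_abs)
        then have "(\<Sum>x\<in>?Z. f x ^ (2 * m)) \<le> (\<Sum>x\<in>?Z. (\<alpha> / 12) ^ (2 * m))" by (intro sum_mono)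
        also have "\<dots> = (1 / 144) ^ m * (real M * \<alpha> ^ (2 * m))"
          by (simp add: power_divide power_mult)
        also have "\<dots> \<le> V" unfolding V_def using S by (intro mult_left_mono) auto
        finally show ?thesis .
      qed
      have lg_shift: "\<bar>lg (x + y) - lg x\<bar> \<le> \<alpha> / 12" for x
      proof -
        have "norm (echar M (r * y) - 1) \<le> ?\<eta>" if r: "r \<in> R" for r
        proof -
          obtain \<epsilon> where "\<forall>\<gamma>\<in>\<Lambda>. \<epsilon> \<gamma> \<in> {-1, 0, 1}" "r mod int M = (\<Sum>\<gamma>\<in>\<Lambda>. \<epsilon> \<gamma> * \<gamma>) mod int M"
            using span[OF r] by blast
          then have "norm (echar M (r * y) - 1) \<le> (\<Sum>\<gamma>\<in>\<Lambda>. norm (echar M (\<gamma> * y) - 1))"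
            by (intro norm_echar_combination_le[OF M]) auto
          also have "\<dots> \<le> (\<Sum>\<gamma>\<in>\<Gamma>. norm (echar M (\<gamma> * y) - 1))"
            by (intro sum_mono2 fin\<Gamma>) (auto simp: \<Gamma>_def)
          also have "\<dots> \<le> ?\<eta>"
          proof (cases "\<Gamma> = {}")
            case False
            then have n: "0 < real (card \<Gamma>)" using fin\<Gamma> by (simp add: card_gt_0_iff)
            have "(\<Sum>\<gamma>\<in>\<Gamma>. norm (echar M (\<gamma> * y) - 1)) \<le> (\<Sum>\<gamma>\<in>\<Gamma>. ?\<eta> / real (card \<Gamma>))"
            proof (rule sum_mono)
              fix \<gamma> assume "\<gamma> \<in> \<Gamma>"
              from near[OF this j] show "norm (echar M (\<gamma> * y) - 1) \<le> ?\<eta> / real (card \<Gamma>)"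
                unfolding y_def pos_le_divide_eq[OF n] .
            qed
            then show ?thesis using n by simp
          qed (use \<eta>0 in simp)
          finally show ?thesis .
        qed
        then have "\<bar>lg (x + y) - lg x\<bar> \<le> sqrt (\<alpha> / \<beta>) * ?\<eta>"
          unfolding lg_def by (rule trig_polynomial_shift_le[OF _ \<eta>0 W_large])
        also have "\<dots> = sqrt (\<alpha> / \<beta> * (\<alpha> * \<beta>)) / 12" by (simp only: real_sqrt_mult times_divide_eq_right)
        also have "\<alpha> / \<beta> * (\<alpha> * \<beta>) = \<alpha>\<^sup>2" using \<beta> by (simp add: power2_eq_square)
        also have "sqrt (\<alpha>\<^sup>2) = \<alpha>" using \<alpha> by simp
        finally show ?thesis .
      qed
      have g_shift': "\<bar>g (x + y) - g x\<bar> \<le> \<alpha> / 12" for x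
      proof -
        have "norm (echar M (r * y) - 1) \<le> ?\<eta>" if r: "r \<in> \<Gamma>'" for r
        proof -
          have r': "r \<in> \<Gamma>" using r by (simp add: \<Gamma>_def)
          then have "1 \<le> real (card \<Gamma>)" using fin\<Gamma> by (auto simp: Suc_le_eq card_gt_0_iff)
          then have "norm (echar M (r * y) - 1) * 1 \<le> norm (echar M (r * y) - 1) * real (card \<Gamma>)"
            by (intro mult_left_mono) auto
          also have "\<dots> \<le> ?\<eta>" unfolding y_def by (rule near[OF r' j])
          finally show ?thesis by simp
        qed
        then have "\<bar>g (x + y) - g x\<bar> \<le> sqrt \<alpha> * ?\<eta>" by (intro g_shift \<eta>0 ballI)
        also have "\<dots> = \<alpha> / 12 * sqrt \<beta>" using \<alpha> by (simp add: real_sqrt_mult)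
        also have "\<dots> \<le> \<alpha> / 12" using \<alpha> \<beta> by (simp add: mult_left_le)
        finally show ?thesis .
      qed
      have HF': "(\<Sum>x\<in>?Z. (- (H (x + y) - F (x + y))) ^ (2 * m)) \<le> V"
      proof -
        have "cyclic M (\<lambda>x. (H x - F x) ^ (2 * m))" using cH cF by (simp add: cyclic_def)
        from shiftinv[OF this] HF show ?thesis by (simp only: power_mult power2_minus)
      qed
      have csm: "cyclic M sm" unfolding sm_def by (rule cyclic_trig_polynomial[OF M])
      have smg': "(\<Sum>x\<in>?Z. (sm (x + y) - g (x + y)) ^ (2 * m)) \<le> V"
      proof -
        have "cyclic M (\<lambda>x. (sm x - g x) ^ (2 * m))" using csm cg by (simp add: cyclic_def)
        from shiftinv[OF this] smg show ?thesis by simp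
      qed
      have smg'': "(\<Sum>x\<in>?Z. (- (sm x - g x)) ^ (2 * m)) \<le> V"
        using smg by (simp only: power_mult power2_minus)
      define e where "e i x = [- (H (x + y) - F (x + y)), H x - F x, lg (x + y) - lg x,
          sm (x + y) - g (x + y), - (sm x - g x), g (x + y) - g x] ! i" for i :: nat and x
      have "F (x + y) - F x = (\<Sum>i<6. e i x)" for x
        by (simp add: e_def H_split numeral_eq_Suc)
      then have "(\<Sum>x\<in>?Z. (F (x + y) - F x) ^ (2 * m)) = (\<Sum>x\<in>?Z. (\<Sum>i<6. e i x) ^ (2 * m))" by simp
      also have "\<dots> \<le> real (card {..<6 :: nat}) ^ (2 * m) * V"
      proof (rule power_sum_add_le[OF _ m])
        fix i :: nat assume "i \<in> {..<6}"
        then consider "i = 0" | "i = 1" | "i = 2" | "i = 3" | "i = 4" | "i = 5" by fastforce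
        then show "(\<Sum>x\<in>?Z. e i x ^ (2 * m)) \<le> V"
          by cases (use HF HF' smg'' smg' const[OF lg_shift] const[OF g_shift'] in \<open>simp_all add: e_def\<close>)
      qed simp
      also have "\<dots> = 36 ^ m * V" by (simp add: power_mult)
      finally show ?thesis by (simp only: y_def)
    qed
    show "\<exists>x. \<forall>j<L. 0 < sumset_density M A B (x + int j * t)"
    proof (rule ccontr)
      assume "\<not> ?thesis"
      then have zero: "\<exists>j<L. F (x + int j * t) = 0" for x
        using sumset_density_nonneg[of M A B] by (metis F_def less_eq_real_def)
      have "F x ^ (2 * m) \<le> (\<Sum>j<L. (F (x + int j * t) - F x) ^ (2 * m))" for x
      proof -
        obtain j where j: "j < L" "F (x + int j * t) = 0" using zero by blast
        have "F x ^ (2 * m) = (F (x + int j * t) - F x) ^ (2 * m)" using j by simp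
        also have "\<dots> \<le> (\<Sum>j<L. (F (x + int j * t) - F x) ^ (2 * m))"
          using j by (intro member_le_sum) auto
        finally show ?thesis .
      qed
      then have "S \<le> (\<Sum>x\<in>?Z. \<Sum>j<L. (F (x + int j * t) - F x) ^ (2 * m))"
        unfolding S_def by (intro sum_mono)
      also have "\<dots> = (\<Sum>j<L. \<Sum>x\<in>?Z. (F (x + int j * t) - F x) ^ (2 * m))" by (rule sum.swap)
      also have "\<dots> \<le> (\<Sum>j<L. 36 ^ m * V)" using diff by (intro sum_mono) auto
      also have "\<dots> = real L * ((36 * (1 / 144)) ^ m * S)"
        unfolding V_def power_mult_distrib by (simp only: sum_constant card_lessThan mult.assoc)
      also have "\<dots> = real L / 4 ^ m * S" by (simp add: power_divide)
      also have "\<dots> < 1 * S"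
      proof (rule mult_strict_right_mono[OF _ S0])
        have "real L < 4 ^ m" using L by (metis of_nat_less_iff of_nat_numeral of_nat_power)
        then show "real L / 4 ^ m < 1" by simp
      qed
      finally show False by simp
    qed
  qed
qed

section \<open>From the cyclic group to the integers\<close>

lemma norm_echar_minus_1_le: "norm (echar M n - 1) \<le> 2 * pi * (\<bar>real_of_int n\<bar> / real M)"
proof -
  let ?y = "2 * pi * (real_of_int n / real M)"
  have "norm (echar M n - 1) = 2 * \<bar>sin (?y / 2)\<bar>"
    using dist_exp_i_1[of ?y] by (simp add: echar_def cis_conv_exp)
  also have "\<dots> \<le> 2 * \<bar>?y / 2\<bar>" by (intro mult_left_mono abs_sin_x_le_abs_x) auto
  finally show ?thesis by (simp add: abs_mult)
qed

text \<open>
  Dirichlet's theorem for the numbers \<open>\<gamma>/M\<close>. Including the frequency 1 makes the step itself small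
  compared with \<open>M\<close> as an integer, so that a progression in the cyclic group does not wrap around.
\<close>
lemma simultaneous_small_multiple:
  fixes Q M :: nat
  assumes \<Gamma>: "finite \<Gamma>" and Q: "0 < Q" "Q ^ (card \<Gamma> + 1) < M"
  obtains t :: int where "t \<noteq> 0" "\<bar>real_of_int t\<bar> * real Q < real M"
    and "\<And>\<gamma> j. \<gamma> \<in> \<Gamma> \<Longrightarrow> norm (echar M (\<gamma> * (int j * t)) - 1) \<le> 2 * pi * (real j / real Q)"
proof -
  define n where "n = card (insert 1 \<Gamma>)"
  have M: "0 < M" using Q by linarith
  have "n \<le> card \<Gamma> + 1" unfolding n_def using \<Gamma> by (simp add: card_insert_if)
  then have "Q ^ n \<le> Q ^ (card \<Gamma> + 1)" using Q by (intro power_increasing) auto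
  then have Qn: "Q ^ n < M" using Q by linarith
  obtain h where h: "bij_betw h {0..<n} (insert 1 \<Gamma>)"
    unfolding n_def using ex_bij_betw_nat_finite[of "insert 1 \<Gamma>"] \<Gamma> by auto
  from Dirichlet_approx_simult[OF Q(1), of n "\<lambda>i. real_of_int (h i) / real M"]
  obtain q p where q: "0 < q" "q \<le> int (Q ^ n)"
    and p: "\<And>i. i < n \<Longrightarrow> \<bar>real_of_int q * (real_of_int (h i) / real M) - real_of_int (p i)\<bar> < 1 / real Q"
    by blast
  have near: "\<exists>z. \<bar>real_of_int (q * \<gamma> - z * int M)\<bar> * real Q < real M" if \<gamma>: "\<gamma> \<in> insert 1 \<Gamma>" for \<gamma>
  proof -
    obtain i where i: "i < n" "h i = \<gamma>" using h \<gamma> by (metis atLeastLessThan_iff bij_betw_iff_bijections)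
    have "real_of_int (q * \<gamma> - p i * int M) = (real_of_int q * (real_of_int \<gamma> / real M) - real_of_int (p i)) * real M"
      using M by (simp add: field_simps)
    then have "\<bar>real_of_int (q * \<gamma> - p i * int M)\<bar> * real Q
        = \<bar>real_of_int q * (real_of_int (h i) / real M) - real_of_int (p i)\<bar> * real Q * real M"
      using i by (simp add: abs_mult)
    also have "\<dots> < 1 * real M"
      using p[OF i(1)] Q M by (intro mult_strict_right_mono) (simp_all add: pos_less_divide_eq)
    finally show ?thesis by auto
  qed
  from near[of 1] obtain z where z: "\<bar>real_of_int (q - z * int M)\<bar> * real Q < real M" by auto
  show ?thesis
  proof (rule that[of "q - z * int M"])
    show "q - z * int M \<noteq> 0"
    proof
      assume "q - z * int M = 0"
      then have "int M dvd q" by (intro dvdI[of _ _ z]) simp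
      then have "int M \<le> q" using q by (intro zdvd_imp_le)
      then show False using q Qn by linarith
    qed
    show "\<bar>real_of_int (q - z * int M)\<bar> * real Q < real M" by (rule z)
    fix \<gamma> and j :: nat assume \<gamma>: "\<gamma> \<in> \<Gamma>"
    obtain y where y: "\<bar>real_of_int (q * \<gamma> - y * int M)\<bar> * real Q < real M"
      using near[of \<gamma>] \<gamma> by auto
    have "(\<gamma> * (int j * (q - z * int M))) mod int M = (int j * (q * \<gamma> - y * int M)) mod int M"
    proof -
      have "\<gamma> * (int j * (q - z * int M)) - int j * (q * \<gamma> - y * int M)
          = int M * (int j * (y - \<gamma> * z))" by (simp add: algebra_simps)
      then show ?thesis unfolding mod_eq_dvd_iff by (metis dvd_triv_left)
    qed
    from echar_cong[OF M this]
    have "norm (echar M (\<gamma> * (int j * (q - z * int M))) - 1)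
        = norm (echar M (int j * (q * \<gamma> - y * int M)) - 1)" by (simp only:)
    also have "\<dots> \<le> 2 * pi * (\<bar>real_of_int (int j * (q * \<gamma> - y * int M))\<bar> / real M)"
      by (rule norm_echar_minus_1_le)
    also have "\<dots> = 2 * pi * (real j * (\<bar>real_of_int (q * \<gamma> - y * int M)\<bar> / real M))"
      by (simp add: abs_mult)
    also have "\<dots> \<le> 2 * pi * (real j * (1 / real Q))"
    proof -
      have "\<bar>real_of_int (q * \<gamma> - y * int M)\<bar> / real M \<le> 1 / real Q"
        using y M Q by (simp add: divide_le_eq pos_le_divide_eq less_imp_le field_simps)
      then show ?thesis by (intro mult_left_mono) auto
    qed
    finally show "norm (echar M (\<gamma> * (int j * (q - z * int M))) - 1) \<le> 2 * pi * (real j / real Q)"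
      by simp
  qed
qed

text \<open>
  The sumset lies in an interval of length less than \<open>2 N\<close> and the progression spans at most \<open>N\<close>, so
  modulo \<open>4 N\<close> two integers involved can only be congruent if they are equal.
\<close>
lemma cyclic_progression_lifts:
  fixes N L :: nat
  assumes AB: "A \<subseteq> {1..int N}" "B \<subseteq> {1..int N}" and L: "0 < L" and t: "t \<noteq> 0" "int L * \<bar>t\<bar> \<le> int N"
    and pos: "\<And>j. j < L \<Longrightarrow> 0 < sumset_density (4 * N) A B (x + int j * t)"
  shows "\<exists>P. is_arith_prog L P \<and> P \<subseteq> A + B"
proof -
  let ?M = "int (4 * N)"
  have rep: "\<exists>s\<in>A + B. (x + int j * t) mod ?M = s mod ?M" if "j < L" for j
    using sumset_density_pos[OF pos[OF that]] by (auto intro: set_plus_intro)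
  have range: "2 \<le> s \<and> s \<le> 2 * int N" if "s \<in> A + B" for s
    using that AB by (force simp: set_plus_def)
  obtain s where s: "s \<in> A + B" "x mod ?M = s mod ?M" using rep[OF L] by auto
  have "s + int j * t \<in> A + B" if j: "j < L" for j
  proof -
    obtain s' where s': "s' \<in> A + B" "(x + int j * t) mod ?M = s' mod ?M" using rep[OF j] by blast
    have "(s + int j * t) mod ?M = s' mod ?M" using s(2) s'(2) by (metis mod_add_left_eq)
    then have dvd: "?M dvd s + int j * t - s'" by (simp add: mod_eq_dvd_iff)
    have "\<bar>int j * t\<bar> \<le> int L * \<bar>t\<bar>" using j by (simp add: abs_mult mult_right_mono)
    then have "\<bar>s + int j * t - s'\<bar> < ?M" using range[OF s(1)] range[OF s'(1)] t(2) by linarith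
    then have "s + int j * t - s' = 0" using dvd_imp_le_int[OF _ dvd] by fastforce
    then show ?thesis using s'(1) by simp
  qed
  then show ?thesis unfolding is_arith_prog_def
    by (intro exI[of _ "{s + int i * t | i. i < L}"]) (use t(1) in auto)
qed

text \<open>
  Here \<open>d\<close> bounds the rank, the frequency 1 included. The choices \<open>l \<approx> 2 lam\<close> and
  \<open>k \<approx> 55296 m l\<^sup>2 / a\<close>, with the densities \<open>a\<close> and \<open>b\<close> modulo \<open>M\<close>, give \<open>k \<le> 3538948 m lam\<^sup>2 / \<alpha>\<close>; Chang's theorem costs a
  further factor of order \<open>lam\<close>, and \<open>184025296 = 52 \<cdot> 3538948\<close>. The hypothesis \<open>size\<close> is what Dirichlet's
  theorem needs for the width \<open>2\<^sup>-\<^sup>4\<^sup>5\<^sup>m\<close>, and \<open>radius\<close> says that \<open>2\<^sup>m\<close> steps of this width stay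
  within the tolerance of the almost periods.
\<close>
lemma sumset_progression:
  fixes N m :: nat and A B :: "int set"
  defines "\<alpha> \<equiv> real (card A) / real N" and "\<beta> \<equiv> real (card B) / real N"
  defines "lam \<equiv> ln (2 / \<beta>)"
  defines "d \<equiv> 184025296 * real m * (lam ^ 3 / \<alpha>)"
  assumes N: "0 < N" and A: "A \<subseteq> {1..int N}" "A \<noteq> {}" and B: "B \<subseteq> {1..int N}" "B \<noteq> {}"
    and m: "0 < m" and size: "45 * real m * d \<le> ln (real N)"
    and radius: "400 * 2 ^ m * d \<le> 2 ^ (45 * m) * sqrt (\<alpha> * \<beta>)"
  shows "\<exists>P. is_arith_prog (2 ^ m) P \<and> P \<subseteq> A + B"
proof -
  define M where "M = 4 * N"
  define a b where "a = real (card A) / real M" and "b = real (card B) / real M"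
  have M: "0 < M" using N by (simp add: M_def)
  have ab: "a = \<alpha> / 4" "b = \<beta> / 4" by (simp_all add: a_def b_def \<alpha>_def \<beta>_def M_def)
  have fin: "finite A" "finite B" using finite_subset[OF A(1)] finite_subset[OF B(1)] by auto
  have "card A \<le> N" "card B \<le> N" using card_mono[OF _ A(1)] card_mono[OF _ B(1)] by auto
  then have \<alpha>: "0 < \<alpha>" "\<alpha> \<le> 1" and \<beta>: "0 < \<beta>" "\<beta> \<le> 1"
    using A B fin N by (auto simp: \<alpha>_def \<beta>_def card_gt_0_iff)
  have "ln 2 \<le> lam" unfolding lam_def using \<beta> by (intro ln_mono) (auto simp: field_simps)
  then have lam: "1 / 2 \<le> lam" "0 < lam" using ln2_ge_two_thirds by auto
  have exp_lam: "exp lam = 2 / \<beta>" using \<beta> by (simp add: lam_def)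
  have inv_b: "1 / b \<le> exp (2 * lam)"
  proof -
    have "exp (2 * lam) = (2 / \<beta>)\<^sup>2" using exp_double[of lam] exp_lam by simp
    moreover have "\<beta>\<^sup>2 \<le> \<beta>" using \<beta> by (simp add: power2_eq_square mult_left_le)
    ultimately show ?thesis using \<beta> by (simp add: ab power_divide frac_le)
  qed
  have b: "0 < b" using \<beta> by (simp add: ab)

  (* 1 / b = 4 / beta is at most exp (2 * lam), and exp l is at most 4 ^ l. *)
  define l where "l = nat \<lceil>2 * lam\<rceil>"
  have l: "2 * lam \<le> real l" "real l \<le> 4 * lam" using lam by (auto simp: l_def) linarith
  have l0: "0 < l" using l lam by (cases l) auto
  have "1 / b \<le> exp (real l)" using inv_b l(1) by (meson exp_le_cancel_iff order.trans)
  also have "exp (real l) = exp 1 ^ l" by (simp add: exp_of_nat_mult[symmetric])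
  also have "\<dots> \<le> 4 ^ l" using exp_le by (intro power_mono) auto
  finally have l_large: "1 / b \<le> 4 ^ l" .

  define k where "k = nat \<lceil>real m * (55296 * (real l)\<^sup>2) / a\<rceil>"
  have a: "0 < a" using \<alpha> by (simp add: ab)
  have k_lower: "real m * (55296 * (real l)\<^sup>2) / a \<le> real k" unfolding k_def by linarith
  have k0: "0 < k"
  proof -
    have "0 < real m * (55296 * (real l)\<^sup>2) / a" using m l0 a by simp
    then show ?thesis using k_lower by (cases k) auto
  qed
  have mk: "real m / real k \<le> a / (55296 * (real l)\<^sup>2)"
    using k_lower k0 l0 a by (simp add: field_simps)
  have k_upper: "real k \<le> 3538948 * (real m * (lam\<^sup>2 / \<alpha>))"
  proof -
    have "real k \<le> real m * (55296 * (real l)\<^sup>2) / a + 1"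
      unfolding k_def using m l0 a by (simp add: of_nat_nat)
    also have "real m * (55296 * (real l)\<^sup>2) / a \<le> real m * (55296 * (4 * lam)\<^sup>2) / a"
      using l(2) a by (intro divide_right_mono mult_left_mono power_mono) auto
    also have "\<dots> = 3538944 * (real m * (lam\<^sup>2 / \<alpha>))"
      by (simp add: ab power2_eq_square)
    also have "1 \<le> 4 * (real m * (lam\<^sup>2 / \<alpha>))"
    proof -
      have "(1 / 2)\<^sup>2 \<le> lam\<^sup>2" using lam by (intro power_mono) auto
      then have "1 / 4 \<le> lam\<^sup>2 / \<alpha>" using \<alpha> by (simp add: power2_eq_square pos_le_divide_eq)
      then have "1 * (1 / 4) \<le> real m * (lam\<^sup>2 / \<alpha>)" using m by (intro mult_mono) auto
      then show ?thesis by linarith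
    qed
    finally show ?thesis by simp
  qed

  have AM: "A \<subseteq> {0..<int M}" and BM: "B \<subseteq> {0..<int M}" using A B by (auto simp: M_def)
  obtain \<Gamma> where \<Gamma>: "finite \<Gamma>" "real (card \<Gamma>) \<le> real k + 16 * ln (2 * (1 / b) ^ k)"
    and prog: "\<And>L t. L < 4 ^ m \<Longrightarrow>
      (\<And>\<gamma> j. \<gamma> \<in> \<Gamma> \<Longrightarrow> j < L \<Longrightarrow> norm (echar M (\<gamma> * (int j * t)) - 1) * real (card \<Gamma>) \<le> sqrt (a * b) / 12) \<Longrightarrow>
      \<exists>x. \<forall>j<L. 0 < sumset_density M A B (x + int j * t)"
    using positive_progression[OF M AM A(2) BM B(2) m k0 l0 l_large[unfolded b_def] mk[unfolded a_def]]
    unfolding a_def b_def by blast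
  have rank: "real (card \<Gamma>) + 1 \<le> d"
  proof -
    have "ln (2 * (1 / b) ^ k) = ln 2 + real k * ln (1 / b)"
      using b by (simp add: ln_mult_pos ln_realpow)
    also have "ln (1 / b) \<le> 2 * lam"
      using inv_b b by (subst ln_exp[symmetric]) (intro ln_mono, auto)
    also have "ln 2 \<le> lam" by fact
    finally have "ln (2 * (1 / b) ^ k) \<le> lam + real k * (2 * lam)"
      by (simp add: mult_left_mono)
    then have "16 * ln (2 * (1 / b) ^ k) \<le> 16 * (lam + real k * (2 * lam))" by (intro mult_left_mono) auto
    then have "real (card \<Gamma>) + 1 \<le> real k + 16 * (lam + real k * (2 * lam)) + 1"
      using \<Gamma>(2) by (meson add_left_mono add_right_mono order.trans)
    also have "\<dots> \<le> 52 * (lam * real k)"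
    proof -
      have "1 \<le> real k" using k0 by simp
      then have "lam * 1 \<le> lam * real k" using lam by (intro mult_left_mono) auto
      moreover have "1 / 2 * real k \<le> lam * real k" using lam by (intro mult_right_mono) auto
      moreover have "16 * (lam + real k * (2 * lam)) = 16 * lam + 32 * (lam * real k)" by simp
      ultimately show ?thesis using \<open>1 \<le> real k\<close> by linarith
    qed
    also have "\<dots> \<le> 52 * (lam * (3538948 * (real m * (lam\<^sup>2 / \<alpha>))))"
      using k_upper lam by (intro mult_left_mono) auto
    also have "\<dots> = d" by (simp add: d_def power2_eq_square power3_eq_cube)
    finally show ?thesis .
  qed

  define Q :: nat where "Q = 2 ^ (45 * m)"
  have Q0: "0 < Q" by (simp add: Q_def)
  have "Q ^ (card \<Gamma> + 1) < M"
  proof -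
    have "real (Q ^ (card \<Gamma> + 1)) = 2 ^ (45 * m * (card \<Gamma> + 1))"
      by (simp add: Q_def power_mult power_add)
    also have "\<dots> \<le> exp 1 ^ (45 * m * (card \<Gamma> + 1))"
      using exp_ge_add_one_self[of 1] by (intro power_mono) auto
    also have "\<dots> = exp (45 * real m * (real (card \<Gamma>) + 1))"
      by (simp add: distrib_left flip: exp_of_nat_mult)
    also have "\<dots> \<le> exp (45 * real m * d)"
      using rank by (simp add: mult_left_mono)
    also have "\<dots> \<le> real N" using size N by (simp add: ln_ge_iff)
    also have "\<dots> < real M" using N by (simp add: M_def)
    finally show ?thesis by (simp only: of_nat_less_iff)
  qed
  from simultaneous_small_multiple[OF \<Gamma>(1) Q0 this] obtain t :: int
    where t: "t \<noteq> 0" "\<bar>real_of_int t\<bar> * real Q < real M"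
      and near: "\<And>\<gamma> j. \<gamma> \<in> \<Gamma> \<Longrightarrow> norm (echar M (\<gamma> * (int j * t)) - 1) \<le> 2 * pi * (real j / real Q)"
    by blast
  have "\<exists>x. \<forall>j<2 ^ m. 0 < sumset_density M A B (x + int j * t)"
  proof (rule prog)
    show "(2 :: nat) ^ m < 4 ^ m" using m by (intro power_strict_mono) auto
    fix \<gamma> and j :: nat assume \<gamma>: "\<gamma> \<in> \<Gamma>" and j: "j < 2 ^ m"
    have j': "real j \<le> 2 ^ m" using j by (metis less_imp_le of_nat_le_iff of_nat_numeral of_nat_power)
    have "norm (echar M (\<gamma> * (int j * t)) - 1) * real (card \<Gamma>) \<le> 2 * pi * (real j / real Q) * d"
      using near[OF \<gamma>] rank by (intro mult_mono) auto
    also have "\<dots> \<le> 8 * (2 ^ m / real Q) * d"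
      using j' pi_less_4 rank by (intro mult_right_mono mult_mono divide_right_mono) auto
    also have "\<dots> \<le> sqrt (\<alpha> * \<beta>) / 48"
    proof -
      have "0 \<le> 2 ^ m * d" using rank by simp
      then have "384 * (2 ^ m * d) \<le> real Q * sqrt (\<alpha> * \<beta>)" using radius by (simp add: Q_def)
      then show ?thesis using Q0 by (simp add: field_simps)
    qed
    also have "\<dots> = sqrt (a * b) / 12"
    proof -
      have "a * b = \<alpha> * \<beta> / 4\<^sup>2" by (simp add: ab)
      then show ?thesis by (simp only: real_sqrt_divide real_sqrt_abs)
    qed
    finally show "norm (echar M (\<gamma> * (int j * t)) - 1) * real (card \<Gamma>) \<le> sqrt (a * b) / 12" .
  qed
  then obtain x where x: "\<And>j. j < 2 ^ m \<Longrightarrow> 0 < sumset_density (4 * N) A B (x + int j * t)"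
    by (auto simp: M_def)
  show ?thesis
  proof (rule cyclic_progression_lifts[OF A(1) B(1) _ t(1) _ x])
    have "(2 :: nat) ^ m * 4 \<le> Q"
    proof -
      have "(2 :: nat) ^ m * 4 = 2 ^ (m + 2)" by simp
      also have "\<dots> \<le> Q" unfolding Q_def using m by (intro power_increasing) auto
      finally show ?thesis .
    qed
    then have "int (2 ^ m * 4) \<le> int Q" by (simp only: of_nat_le_iff)
    then have "int (2 ^ m) * 4 \<le> int Q" by simp
    then have "\<bar>t\<bar> * (int (2 ^ m) * 4) \<le> \<bar>t\<bar> * int Q" by (intro mult_left_mono) auto
    also have "\<dots> < int M"
    proof -
      have "real_of_int (\<bar>t\<bar> * int Q) < real_of_int (int M)" using t(2) by simp
      then show ?thesis by (simp only: of_int_less_iff)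
    qed
    finally show "int (2 ^ m) * \<bar>t\<bar> \<le> int N" by (simp add: M_def mult_ac)
  qed simp_all
qed

section \<open>The choice of parameters\<close>

theorem theorem1p3:
  shows "\<exists>c::real. c > 0 \<and>
    (\<forall>(N::nat) (A::int set) (B::int set).
       N \<ge> 3 \<longrightarrow> A \<subseteq> {1..int N} \<longrightarrow> B \<subseteq> {1..int N} \<longrightarrow> A \<noteq> {} \<longrightarrow> B \<noteq> {} \<longrightarrow>
       (let \<alpha> = real (card A) / real N; \<beta> = real (card B) / real N in
          \<exists>L P. is_arith_prog L P \<and> P \<subseteq> A + B \<and>
            real L \<ge> exp (c * sqrt (\<alpha> * ln (real N) / (ln (2 * inverse \<beta>)) ^ 3)
                             - ln (inverse \<beta> * ln (real N)))))"
proof -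
  have ln3: "1 < ln (3 :: real)" using e_less_272 ln_less_cancel_iff[of "exp 1" 3] by simp
  (* The second bound on c forces p > 10^5 whenever the claim is not trivial, so that m is positive. *)
  define c :: real where "c = min (1 / 10 ^ 7) (ln (ln 3) / 10 ^ 5)"
  have c: "0 < c" "c \<le> 1 / 10 ^ 7" "c * 10 ^ 5 \<le> ln (ln 3)"
    using ln3 by (auto simp: c_def min_def field_simps)
  have "\<exists>L P. is_arith_prog L P \<and> P \<subseteq> A + B \<and>
      real L \<ge> exp (c * sqrt (\<alpha> * ln (real N) / (ln (2 * inverse \<beta>)) ^ 3) - ln (inverse \<beta> * ln (real N)))"
    if N: "N \<ge> 3" and A: "A \<subseteq> {1..int N}" "A \<noteq> {}" and B: "B \<subseteq> {1..int N}" "B \<noteq> {}"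
      and \<alpha>_def: "\<alpha> = real (card A) / real N" and \<beta>_def: "\<beta> = real (card B) / real N"
    for N A B \<alpha> \<beta>
  proof -
    define lam where "lam = ln (2 / \<beta>)"
    define p where "p = sqrt (\<alpha> * ln (real N) / lam ^ 3)"
    define u where "u = ln (real N) / \<beta>"
    have fin: "finite A" "finite B" using finite_subset[OF A(1)] finite_subset[OF B(1)] by auto
    have "card A \<le> N" "card B \<le> N" using card_mono[OF _ A(1)] card_mono[OF _ B(1)] by auto
    then have \<alpha>: "0 < \<alpha>" "\<alpha> \<le> 1" and \<beta>: "0 < \<beta>" "\<beta> \<le> 1"
      using A B fin N by (auto simp: \<alpha>_def \<beta>_def card_gt_0_iff)
    have "ln 2 \<le> lam" unfolding lam_def using \<beta> by (intro ln_mono) (auto simp: field_simps)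
    then have lam: "1 / 2 \<le> lam" "0 < lam" using ln2_ge_two_thirds by auto
    have lnN: "ln 3 \<le> ln (real N)" using N by (intro ln_mono) auto
    then have lnN0: "0 < ln (real N)" using ln3 by linarith
    have u_lnN: "ln (real N) \<le> u" using lnN0 \<beta> by (simp add: u_def field_simps)
    then have u: "ln 3 \<le> u" "1 < u" using lnN ln3 by auto
    have goal: "\<exists>L P. is_arith_prog L P \<and> P \<subseteq> A + B \<and> real L \<ge> exp (c * p - ln u)"
    (* If c * p is at most ln u the bound asks for a progression of length 1 only. *)
    proof (cases "c * p \<le> ln u")
      case True
      obtain a b where ab: "a \<in> A" "b \<in> B" using A B by blast
      have "is_arith_prog 1 {a + b}" unfolding is_arith_prog_def
        by (intro exI[of _ "a + b"] exI[of _ 1]) auto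
      moreover have "{a + b} \<subseteq> A + B" using ab by (auto intro: set_plus_intro)
      moreover have "exp (c * p - ln u) \<le> real 1" using True by simp
      ultimately show ?thesis by blast
    next
      case False
      have "c * 10 ^ 5 \<le> ln u" using c(3) u ln3 by (intro order.trans[OF c(3)] ln_mono) auto
      then have "c * 10 ^ 5 < c * p" using False by linarith
      then have p5: "10 ^ 5 < p" using c(1) by simp
      define m where "m = nat \<lfloor>p / 10 ^ 5\<rfloor>"
      have m1: "1 \<le> p / 10 ^ 5" using p5 by simp
      then have m_le: "real m \<le> p / 10 ^ 5" unfolding m_def by (intro of_nat_floor) linarith
      have m_gt: "p / 10 ^ 5 < real m + 1" unfolding m_def using m1 by linarith
      have m0: "0 < m" using m1 by (simp add: m_def)
      then have m_ge: "p / (2 * 10 ^ 5) \<le> real m" using m_gt by simp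
      have p2: "p\<^sup>2 = \<alpha> * ln (real N) / lam ^ 3"
        using \<alpha> lnN0 lam by (simp add: p_def)
      then have ratio: "lam ^ 3 / \<alpha> = ln (real N) / p\<^sup>2"
        using \<alpha> lnN0 lam p5 by (simp add: field_simps)
      define d where "d = 184025296 * real m * (lam ^ 3 / \<alpha>)"
      have d0: "0 \<le> d" using lam \<alpha> by (simp add: d_def)
      have "(real m)\<^sup>2 \<le> (p / 10 ^ 5)\<^sup>2" using m_le by (intro power_mono) auto
      then have m2: "10 ^ 10 * (real m)\<^sup>2 \<le> p\<^sup>2" by (simp add: power_divide)
      (* 8281138320 = 45 * 184025296 is less than 10^10, which fixes m as p / 10^5 up to rounding. *)
      have size: "45 * real m * d \<le> ln (real N)"
      proof -
        have "45 * real m * d = (8281138320 * (real m)\<^sup>2) * (ln (real N) / p\<^sup>2)"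
          by (simp add: d_def ratio power2_eq_square)
        also have "\<dots> \<le> p\<^sup>2 * (ln (real N) / p\<^sup>2)"
        proof (rule mult_right_mono)
          have "0 \<le> (real m)\<^sup>2" by simp
          then have "8281138320 * (real m)\<^sup>2 \<le> 10 ^ 10 * (real m)\<^sup>2" by simp
          then show "8281138320 * (real m)\<^sup>2 \<le> p\<^sup>2" using m2 by (rule order.trans)
        qed (use lnN0 in simp)
        also have "\<dots> = ln (real N)" using p5 by simp
        finally show ?thesis .
      qed
      (* Non-triviality is used again here: it bounds 1 / beta and ln N in terms of m. *)
      have u_le: "u \<le> exp (real m)"
      proof -
        have "ln u \<le> c * p" using False by simp
        also have "\<dots> \<le> 1 / 10 ^ 7 * p" using c(2) p5 by (intro mult_right_mono) auto
        also have "\<dots> \<le> real m" using m_ge p5 by simp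
        finally show ?thesis using u by (metis exp_ln exp_le_cancel_iff less_trans zero_less_one)
      qed
      have radius: "400 * 2 ^ m * d \<le> 2 ^ (45 * m) * sqrt (\<alpha> * \<beta>)"
      proof -
        have p1: "1 \<le> p\<^sup>2" using p5 by (simp add: one_le_power)
        then have shrink: "ln (real N) / p\<^sup>2 \<le> ln (real N)"
          using divide_left_mono[of 1 "p\<^sup>2" "ln (real N)"] lnN0 p5 by simp
        have lam3: "1 / 8 \<le> lam ^ 3" using power_mono[OF lam(1), of 3] by (simp add: power_divide)
        have inv_\<alpha>: "1 / \<alpha> \<le> 8 * ln (real N)"
        proof -
          have "1 / 8 * (1 / \<alpha>) \<le> lam ^ 3 * (1 / \<alpha>)" using lam3 \<alpha> by (intro mult_right_mono) auto
          also have "\<dots> = ln (real N) / p\<^sup>2" using ratio by simp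
          also have "\<dots> \<le> ln (real N)" by (rule shrink)
          finally show ?thesis by simp
        qed
        have "d = 184025296 * real m * (ln (real N) / p\<^sup>2)" by (simp only: d_def ratio)
        also have "\<dots> \<le> 184025296 * real m * ln (real N)"
          using shrink by (intro mult_left_mono) auto
        finally have d_le: "d \<le> 184025296 * real m * ln (real N)" .
        have "d / (\<alpha> * \<beta>) = d * (1 / \<alpha>) * (1 / \<beta>)" by simp
        also have "\<dots> \<le> (184025296 * real m * ln (real N)) * (8 * ln (real N)) * (1 / \<beta>)"
          using d_le inv_\<alpha> d0 \<alpha> \<beta> lnN0 by (intro mult_right_mono mult_mono) auto
        also have "\<dots> = 1472202368 * real m * (ln (real N) * u)" by (simp add: u_def)
        also have "\<dots> \<le> 1472202368 * 2 ^ m * (u * u)"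
          using u_lnN u lnN0 of_nat_less_two_power[of m, where 'a = real] by (intro mult_mono) auto
        also have "\<dots> \<le> 1472202368 * 2 ^ m * (exp (real m) * exp (real m))"
          using u_le u by (intro mult_left_mono mult_mono) auto
        also have "exp (real m) * exp (real m) = (exp 1 * exp 1) ^ m"
          by (simp add: power_mult_distrib exp_of_nat_mult[symmetric])
        also have "\<dots> \<le> 9 ^ m"
        proof -
          have "exp 1 * exp 1 \<le> (3 * 3 :: real)" using exp_le by (intro mult_mono) auto
          then show ?thesis by (intro power_mono) auto
        qed
        finally have d_ratio: "d / (\<alpha> * \<beta>) \<le> 1472202368 * 2 ^ m * 9 ^ m" by simp
        have "400 * 2 ^ m * (1472202368 * 2 ^ m * 9 ^ m) = 588880947200 * ((2 * 2 * 9) ^ m :: real)"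
          unfolding power_mult_distrib by simp
        (* The exponent 45 is the least for which 36 * 588880947200 is at most 2 ^ 45. *)
        also have "\<dots> \<le> 588880947200 ^ m * (2 * 2 * 9) ^ m"
          using power_increasing[of 1 m "588880947200 :: real"] m0 by (intro mult_right_mono) auto
        also have "\<dots> = (588880947200 * (2 * 2 * 9)) ^ m" by (rule power_mult_distrib[symmetric])
        also have "\<dots> \<le> (2 ^ 45) ^ m" by (intro power_mono) auto
        also have "\<dots> = 2 ^ (45 * m)" by (rule power_mult[symmetric])
        finally have const: "400 * 2 ^ m * (1472202368 * 2 ^ m * 9 ^ m) \<le> (2 ^ (45 * m) :: real)" .
        have ab: "0 \<le> \<alpha> * \<beta>" "\<alpha> * \<beta> \<le> 1" using \<alpha> \<beta> by (auto intro: mult_le_one)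
        have "400 * 2 ^ m * d = 400 * 2 ^ m * (d / (\<alpha> * \<beta>)) * (\<alpha> * \<beta>)" using \<alpha> \<beta> by simp
        also have "\<dots> \<le> 400 * 2 ^ m * (1472202368 * 2 ^ m * 9 ^ m) * (\<alpha> * \<beta>)"
          using d_ratio ab by (intro mult_right_mono mult_left_mono) auto
        also have "\<dots> \<le> 2 ^ (45 * m) * (\<alpha> * \<beta>)" using const ab by (intro mult_right_mono)
        also have "\<dots> \<le> 2 ^ (45 * m) * sqrt (\<alpha> * \<beta>)"
          using ab by (intro mult_left_mono real_le_rsqrt) (auto simp: power2_eq_square mult_left_le)
        finally show ?thesis .
      qed
      have "\<exists>P. is_arith_prog (2 ^ m) P \<and> P \<subseteq> A + B"
        using sumset_progression[of N A B m] N A B m0 size radius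
        unfolding d_def lam_def \<alpha>_def \<beta>_def by simp
      moreover have "exp (c * p - ln u) \<le> real (2 ^ m)"
      proof -
        have "c * p - ln u \<le> c * p" using u by simp
        also have "\<dots> \<le> 1 / 10 ^ 7 * p" using c(2) p5 by (intro mult_right_mono) auto
        also have "\<dots> \<le> 1 / 2 * real m" using m_ge p5 by simp
        also have "\<dots> \<le> ln 2 * real m" using ln2_ge_two_thirds by (intro mult_right_mono) auto
        finally have "exp (c * p - ln u) \<le> exp (ln 2 * real m)" by simp
        also have "\<dots> = 2 ^ m" by (simp add: exp_of_nat2_mult)
        finally show ?thesis by simp
      qed
      ultimately show ?thesis by blast
    qed
    then show ?thesis by (simp add: p_def u_def lam_def divide_inverse mult.commute)
  qed
  then show ?thesis using c(1) unfolding Let_def by (intro exI[of _ c]) auto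
qed

end
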